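(* Let $d\ge2$ be an integer and let $\rho\colon\mathcal{I}\times\mathcal{I}\to\mathbb{R}$ be a distance function such that $r_n:=\rho_I$ depends only on $n$ for $I\in\mathcal{I}_n$. Suppose that $\rho$ has bounded growth and that $r_n\sim r_n^*$, i.e. there is a constant $c\geq 1$ independent of $n$ with $r_n\le c\,r_n^*$ and $r_n^*\le c\,r_n$ for all $n$. Then there exist nonempty bounded sets $A_I\subset\mathbb{R}^d$ ($I\in\mathcal{I}$) such that (i) $A_I\subset A_J$ if $I\subset J$, (ii) $A_I\cap A_J=\emptyset$ if $I\cap J=\emptyset$, (iii) $\operatorname{dist}(A_I,A_J)\ge\rho(I,J)$ if $I\cap J=\emptyset$, if and only if $\sum_n 2^{n/d}r_n<\infty$.
   Context: For $n\ge1$, $\mathcal{I}_n$ is the set of sequences of $0$'s and $1$'s of length $n$, and $\mathcal{I}=\bigcup_{n\ge1}\mathcal{I}_n$. For $I,J\in\mathcal{I}$ write $J\subset I$ if the sequence $J$ is a continuation of the sequence $I$ (including $J=I$), and $I\cap J=\emptyset$ if neither is a continuation of the other. For $S\subset\mathbb{R}^d$ and $r>0$, $B(S,r)$ is the open $r$-neighborhood of $S$; $\chi_S$ is the indicator function of $S$. A distance function is a map $\rho\colon\mathcal{I}\times\mathcal{I}\to\mathbb{R}$ such that for all $I,J,K\in\mathcal{I}$: $\rho(I,J)\ge0$, and $\rho(I,J)=0$ if $I\subset J$ or $J\subset I$; $\rho(I,J)=\rho(J,I)$; $\rho(I,K)\le\rho(J,K)$ if $J\subset I$. For $J\subset I$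 put $\rho_{J,I}:=\inf\{\rho(J,K): K\in\mathcal I,\ K\cap I=\emptyset\}$ and $\rho_I:=\sup_{J\subset I}\rho_{J,I}$. It is assumed that $\rho_I$ (finite) depends only on the length $n$ of $I$, and $r_n$ denotes this common value. For $n\ge1$, $r_n^*\in[0,\infty]$ denotes the supremum of $\rho(J_1,J_2)$ over all $J_1,J_2\in\mathcal{I}$ of length at least $n$ whose first $n-1$ terms agree and whose $n$-th terms differ. Bounded growth: $\rho$ has bounded growth if the following implication holds: if sets $A_I$ as in the claim (nonempty, bounded, satisfying (i)-(iii)) exist, then $(r_n)$ is a decreasing sequence of positive reals converging to $0$, and there are $C,q\in\mathbb{N}=\{1,2,\dots\}$ and numbers $k_{n,m}>0$ ($m\ge n\ge1$) with $k_{n,m}\ge c\,r_n/r_m$ for some constant $c>0$ independent of $n,m$, with $\sup_n\sum_{m\ge n}2^{(m-n)/d}k_{n,m}^{-1}<\infty$, and with $2^{(m-n)/d}k_{n,m}^{-1}<(4C)^{-1}$ whenever $m-n$ is large enough, such that there exists an admissible system of sets in $\mathbb{R}^d$ for the data $\big(C,q,(r_n),(k_{n,m})\big)$. An admissible system of sets for the data $\big(C,q,(r_n),(k_{n,m})\big)$ consists of bounded Lebesgue measurable sets $C_I\subset\mathbb{R}^d$ for $I\in\mathcal{I}$, satisfying $C_I\subset C_J$ if $I\subset J$ and $C_I\cap C_J=\emptyset$ if $I\cap J=\emptyset$, and, for all $m\ge n\ge1$, $I\in\mathcal{I}_n$ and integers $j\ge0$, bounded Lebesgue measurable sets $E_{I,j}=E_{I,j}^{(m)}\subset\mathbb{R}^d$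 (depending on $m$ too) with annuli $D_{I,j}=D_{I,j}^{(m)}:=B(E_{I,j},r_m)\setminus E_{I,j}$, such that for some constant $c_0\ge1$ (independent of $n,m,k,j,x$ and of all elements of $\mathcal I$) the following hold. (P1) For each $n\ge 1$, $I\in\mathcal{I}_n$ and $m\ge n$, there are at most $c_0$ many $I'\in\mathcal{I}_m$ with $I'\cap I=\emptyset$ and $B(C_I,r_m)\cap B(C_{I'},r_m)\ne\emptyset$. (P2) For each $n\ge1$ and $I\in\mathcal{I}_n$, $C_I$ contains a ball of radius at least $r_n/c_0$. (P3) $C_I\subset E_{I,j}$ for all $m\ge n\ge1$, $I\in\mathcal{I}_n$ and all $j$. (P4) For all $m\ge n\ge 1$ and $J\in\mathcal{I}_m$ there are at most $C$ many pairs $(I,j)$ with $I\in\mathcal{I}_n$, $0\le j<k_{n,m}$ such that $D_{I,j}^{(m)}\cap C_J\ne\emptyset$. (P5) For all $m>n\ge 1$ and $x\in\mathbb{R}^d$, $\sum_{I\in\mathcal{I}_n,\,0\le j<k_{n,m}}\chi_{D_{I,j}^{(m)}}(x)\le c_0\,k_{n,m}r_m/r_n$. Moreover, for every $k\ge1$, $I\in\mathcal{I}_k$ and $n\ge k+q$ there is a nonempty set $\mathcal{I}_n'=\mathcal{I}_n'(I)\subset\{I'\in\mathcal{I}_n: I'\subset I\}$ such that for every $n\ge k+q$ and $m\ge n+q$: (P6) $D_{I',j}^{(m)}\subset C_I$ for every $I'\in\mathcal{I}_n'(I)$ and $0\le j<k_{n,m}$. (P7) If $D_{I',j}^{(m)}\cap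 C_{I''}\ne\emptyset$ for some $I'\in\mathcal{I}_n'(I)$, $0\le j<k_{n,m}$ and $I''\in\mathcal{I}_m$, then $I''\in\mathcal{I}_m'(I)$. *)

theory Defs
  imports "HOL-Analysis.Analysis" "HOL-Library.Sublist"
begin

text \<open>
  Index sequences are nonempty boolean lists.  A sequence \<open>J\<close> continues \<open>I\<close>
  (written \<open>J \<subset> I\<close> on paper) when \<open>prefix I J\<close>; neither continues the other
  (written \<open>I \<inter> J = \<emptyset>\<close>) when \<open>I \<parallel> J\<close>, which forces both to be nonempty.
  Functions of a level \<open>n\<close> matter only for \<open>n \<ge> 1\<close>.
\<close>

abbreviation words :: "nat \<Rightarrow> bool list set" where
  "words n \<equiv> {I. length I = n}"

locale distance_function =
  fixes \<rho> :: "bool list \<Rightarrow> bool list \<Rightarrow> real"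
  assumes nonneg: "\<lbrakk>I \<noteq> []; J \<noteq> []\<rbrakk> \<Longrightarrow> 0 \<le> \<rho> I J"
    and zero: "\<lbrakk>I \<noteq> []; J \<noteq> []; prefix I J \<or> prefix J I\<rbrakk> \<Longrightarrow> \<rho> I J = 0"
    and sym: "\<lbrakk>I \<noteq> []; J \<noteq> []\<rbrakk> \<Longrightarrow> \<rho> I J = \<rho> J I"
    and mono: "\<lbrakk>I \<noteq> []; J \<noteq> []; K \<noteq> []; prefix I J\<rbrakk> \<Longrightarrow> \<rho> I K \<le> \<rho> J K"

definition escape_dist ::
    "(bool list \<Rightarrow> bool list \<Rightarrow> real) \<Rightarrow> bool list \<Rightarrow> bool list \<Rightarrow> real" where
  "escape_dist \<rho> J I = (INF K \<in> {K. K \<parallel> I}. \<rho> J K)"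

text \<open>\<open>ereal\<close>-valued, so that finiteness of the supremum is a genuine assumption.\<close>

definition escape_radius :: "(bool list \<Rightarrow> bool list \<Rightarrow> real) \<Rightarrow> bool list \<Rightarrow> ereal" where
  "escape_radius \<rho> I = (SUP J \<in> {J. prefix I J}. ereal (escape_dist \<rho> J I))"

definition split_sup :: "(bool list \<Rightarrow> bool list \<Rightarrow> real) \<Rightarrow> nat \<Rightarrow> ereal" where
  "split_sup \<rho> n =
    (SUP (J\<^sub>1, J\<^sub>2) \<in> {(J\<^sub>1, J\<^sub>2). n \<le> length J\<^sub>1 \<and> n \<le> length J\<^sub>2 \<and>
        take (n - 1) J\<^sub>1 = take (n - 1) J\<^sub>2 \<and> J\<^sub>1 ! (n - 1) \<noteq> J\<^sub>2 ! (n - 1)}.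
      ereal (\<rho> J\<^sub>1 J\<^sub>2))"

definition separated_system ::
    "(bool list \<Rightarrow> bool list \<Rightarrow> real) \<Rightarrow> (bool list \<Rightarrow> (real ^ 'd) set) \<Rightarrow> bool" where
  "separated_system \<rho> A \<longleftrightarrow>
    (\<forall>I. I \<noteq> [] \<longrightarrow> A I \<noteq> {} \<and> bounded (A I)) \<and>
    (\<forall>I J. I \<noteq> [] \<and> J \<noteq> [] \<and> prefix J I \<longrightarrow> A I \<subseteq> A J) \<and>
    (\<forall>I J. I \<parallel> J \<longrightarrow> A I \<inter> A J = {}) \<and>
    (\<forall>I J. I \<parallel> J \<longrightarrow> \<rho> I J \<le> setdist (A I) (A J))"

text \<open>Not defined through \<open>infdist\<close>, since \<open>infdist x {} = 0\<close>.\<close>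

definition nbhd :: "'a::metric_space set \<Rightarrow> real \<Rightarrow> 'a set" where
  "nbhd S r = (\<Union>y\<in>S. ball y r)"

definition annulus :: "'a::metric_space set \<Rightarrow> real \<Rightarrow> 'a set" where
  "annulus S r = nbhd S r - S"

text \<open>
  \<open>S I\<close>, \<open>E m I j\<close> and \<open>W I n\<close> stand for $C_I$, $E_{I,j}^{(m)}$ and $\mathcal{I}_n'(I)$.
  All sets under \<open>card\<close> and \<open>\<Sum>\<close> are finite, because \<open>words n\<close> is finite and \<open>j\<close> is bounded
  by \<open>k n m\<close>.
\<close>

locale admissible_system =
  fixes C q :: nat
    and r :: "nat \<Rightarrow> real"
    and k :: "nat \<Rightarrow> nat \<Rightarrow> real"
    and S :: "bool list \<Rightarrow> (real ^ 'd) set"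
    and E :: "nat \<Rightarrow> bool list \<Rightarrow> nat \<Rightarrow> (real ^ 'd) set"
    and W :: "bool list \<Rightarrow> nat \<Rightarrow> bool list set"
    and c0 :: real
  assumes c0_ge_1: "1 \<le> c0"
    and S_measurable: "I \<noteq> [] \<Longrightarrow> bounded (S I) \<and> S I \<in> sets lebesgue"
    and S_mono: "\<lbrakk>I \<noteq> []; J \<noteq> []; prefix J I\<rbrakk> \<Longrightarrow> S I \<subseteq> S J"
    and S_disjoint: "I \<parallel> J \<Longrightarrow> S I \<inter> S J = {}"
    and E_measurable: "\<lbrakk>1 \<le> n; n \<le> m; I \<in> words n\<rbrakk>
      \<Longrightarrow> bounded (E m I j) \<and> E m I j \<in> sets lebesgue"
    and few_neighbours: "\<lbrakk>1 \<le> n; n \<le> m; I \<in> words n\<rbrakk>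
      \<Longrightarrow> real (card {I' \<in> words m. I' \<parallel> I \<and> nbhd (S I) (r m) \<inter> nbhd (S I') (r m) \<noteq> {}}) \<le> c0"
    and S_contains_ball: "\<lbrakk>1 \<le> n; I \<in> words n\<rbrakk> \<Longrightarrow> \<exists>x s. r n / c0 \<le> s \<and> ball x s \<subseteq> S I"
    and S_subset_E: "\<lbrakk>1 \<le> n; n \<le> m; I \<in> words n\<rbrakk> \<Longrightarrow> S I \<subseteq> E m I j"
    and few_annuli_meet: "\<lbrakk>1 \<le> n; n \<le> m; J \<in> words m\<rbrakk>
      \<Longrightarrow> card {(I, j). I \<in> words n \<and> real j < k n m \<and> annulus (E m I j) (r m) \<inter> S J \<noteq> {}} \<le> C"
    and annuli_overlap: "\<lbrakk>1 \<le> n; n < m\<rbrakk>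
      \<Longrightarrow> (\<Sum>(I, j) \<in> {(I, j). I \<in> words n \<and> real j < k n m}.
            indicat_real (annulus (E m I j) (r m)) x) \<le> c0 * k n m * r m / r n"
    and W_subwords: "\<lbrakk>I \<noteq> []; length I + q \<le> n\<rbrakk>
      \<Longrightarrow> W I n \<noteq> {} \<and> W I n \<subseteq> {I' \<in> words n. prefix I I'}"
    and annuli_inside: "\<lbrakk>I \<noteq> []; length I + q \<le> n; n + q \<le> m; I' \<in> W I n; real j < k n m\<rbrakk>
      \<Longrightarrow> annulus (E m I' j) (r m) \<subseteq> S I"
    and W_closed: "\<lbrakk>I \<noteq> []; length I + q \<le> n; n + q \<le> m; I' \<in> W I n; real j < k n m;
        I'' \<in> words m; annulus (E m I' j) (r m) \<inter> S I'' \<noteq> {}\<rbrakk> \<Longrightarrow> I'' \<in> W I m"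

definition bounded_growth ::
    "'d::finite itself \<Rightarrow> (bool list \<Rightarrow> bool list \<Rightarrow> real) \<Rightarrow> (nat \<Rightarrow> real) \<Rightarrow> bool" where
  "bounded_growth _ \<rho> r \<longleftrightarrow>
    ((\<exists>A :: bool list \<Rightarrow> (real ^ 'd) set. separated_system \<rho> A) \<longrightarrow>
      (\<forall>n\<ge>1. 0 < r n) \<and> (\<forall>n m. 1 \<le> n \<and> n \<le> m \<longrightarrow> r m \<le> r n) \<and> r \<longlonglongrightarrow> 0 \<and>
      (\<exists>(C::nat) (q::nat) (k :: nat \<Rightarrow> nat \<Rightarrow> real).
        1 \<le> C \<and> 1 \<le> q \<and>
        (\<forall>n m. 1 \<le> n \<and> n \<le> m \<longrightarrow> 0 < k n m) \<and>
        (\<exists>c>0. \<forall>n m. 1 \<le> n \<and> n \<le> m \<longrightarrow> c * r n / r m \<le> k n m) \<and>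
        (SUP n\<in>{1..}. \<Sum>i. ennreal (2 powr (real i / real CARD('d)) / k n (n + i))) < \<infinity> \<and>
        (\<exists>N. \<forall>n m. 1 \<le> n \<and> n + N \<le> m \<longrightarrow>
          2 powr (real (m - n) / real CARD('d)) / k n m < 1 / (4 * real C)) \<and>
        (\<exists>(S :: bool list \<Rightarrow> (real ^ 'd) set) E W c0. admissible_system C q r k S E W c0)))"

end

theory Submission
  imports Defs
begin

text \<open>
  Put \<open>a n = 2 powr (n / d) * r n\<close> with \<open>d = CARD('d)\<close>.

  If \<open>a\<close> is summable, a Cantor set does the job. Two words that first differ at level \<open>n\<close> must be
  kept apart by at most a constant times \<open>r n\<close>. Splitting boxes in the coordinate directions
  cyclically, a gap of this size at level \<open>n\<close> costs about \<open>2 powr (n / d) * r n\<close> of the side length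
  of the initial box, and summability says that the total cost is finite
  (\<open>separated_system_exists\<close>).

  Conversely, let a separated system exist. Bounded growth then provides an admissible system, and
  the summability follows from its geometry (\<open>summable_radii\<close>). The quantity that is followed
  through the levels is the least measure of the sets \<open>S I\<close> of level \<open>n\<close>, multiplied by \<open>2 ^ n\<close>. It
  does not increase with \<open>n\<close>, and it decreases by at least the relative measure of the points
  of \<open>S I\<close> that are lost before level \<open>m\<close>. If the annuli around a set of level \<open>n\<close> consist, in a
  fixed proportion, of such lost points, then the loss is of order \<open>a n\<close>. Otherwise the annuli are
  covered by sets of level \<open>m\<close>, and there are so many annuli that on average they meet only few
  such sets. Now an annulus separates the set inside from infinity, so that every line through
  the inner set meets the annulus. The few sets that cover it must therefore have large shadows,
  that is, large projections to the coordinate hyperplanes (\<open>shadow_area_annulus\<close>,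
  \<open>shadow_recursion\<close>). After rescaling, the shadows thus grow geometrically along a sequence of
  scales as long as nothing is lost, whereas bounded overlap limits them by a multiple of
  \<open>1 / a n\<close> (\<open>total_shadow_bounded\<close>). So a loss has to occur, and the summability of
  \<open>2 powr ((m - n) / d) / k n m\<close> over \<open>m\<close> allows choosing the scales so that this loss is
  comparable to the sum of \<open>a\<close> over all scales passed (\<open>chain_block\<close>).

  The shadows at the start of the chain are bounded below in terms of the measure \<open>V\<close> of the set by
  \<open>V powr ((d - 1) / d)\<close> (\<open>loomis_whitney\<close>). Hence for \<open>y n\<close>, the \<open>d\<close>-th root of the rescaled least
  measure, the loss estimate reads \<open>y l ^ d - y e ^ d \<ge> c * y l ^ (d - 1) * (\<Sum> a)\<close>. Thus
  \<open>y l - y e\<close> bounds the sum of \<open>a\<close> between the levels \<open>l\<close> and \<open>e\<close>, and adding up over consecutive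
  blocks bounds the sum of \<open>a\<close> by a multiple of \<open>y 1\<close>.
\<close>

section \<open>Shadows and integration along lines\<close>

definition slab :: "'a::euclidean_space \<Rightarrow> 'a set" where
  "slab b = {x. 0 \<le> x \<bullet> b \<and> x \<bullet> b \<le> 1}"

text \<open>
  The orthogonal projection of \<open>X\<close> along \<open>b\<close> is represented by the cylinder over it, cut to
  thickness one. Its Lebesgue measure in the full space is then the measure of the projection,
  and no lower-dimensional space has to be introduced.
\<close>

definition shadow :: "'a::euclidean_space \<Rightarrow> 'a set \<Rightarrow> 'a set" where
  "shadow b X = {x \<in> slab b. \<exists>t. x + t *\<^sub>R b \<in> X}"

text \<open>
  An outer measure is needed, since projections of measurable sets need not be measurable.
\<close>

definition shadow_area :: "'a::euclidean_space set \<Rightarrow> ennreal" where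
  "shadow_area X = (\<Sum>b\<in>Basis. outer_measure_of lborel (shadow b X))"

lemma slab_measurable [measurable]: "slab b \<in> sets borel"
  unfolding slab_def by measurable

lemma nn_integral_lborel_shift:
  fixes f :: "'a::euclidean_space \<Rightarrow> ennreal"
  assumes [measurable]: "f \<in> borel_measurable borel"
  shows "(\<integral>\<^sup>+x. f (x + c) \<partial>lborel) = (\<integral>\<^sup>+x. f x \<partial>lborel)"
proof -
  have "(\<integral>\<^sup>+x. f x \<partial>lborel) = (\<integral>\<^sup>+x. f x \<partial>distr lborel borel ((+) c))"
    by (simp add: lborel_distr_plus)
  also have "\<dots> = (\<integral>\<^sup>+x. f (c + x) \<partial>lborel)"
    by (rule nn_integral_distr) auto
  finally show ?thesis by (simp add: add.commute)
qed

text \<open>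
  By Tonelli and translation invariance the left-hand side is the integral of \<open>f x\<close> times the
  length of the set of those \<open>t\<close> for which \<open>x - t *\<^sub>R b\<close> lies in the slab, and this length is 1.
\<close>

lemma nn_integral_lines:
  fixes f :: "'a::euclidean_space \<Rightarrow> ennreal"
  assumes f[measurable]: "f \<in> borel_measurable borel" and b: "b \<in> Basis"
  shows "(\<integral>\<^sup>+x. indicator (slab b) x * (\<integral>\<^sup>+t. f (x + t *\<^sub>R b) \<partial>lborel) \<partial>lborel)
    = (\<integral>\<^sup>+x. f x \<partial>lborel)"
proof -
  have bb: "b \<bullet> b = 1" using b by (simp add: inner_Basis)
  have "(\<integral>\<^sup>+x. indicator (slab b) x * (\<integral>\<^sup>+t. f (x + t *\<^sub>R b) \<partial>lborel) \<partial>lborel)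
    = (\<integral>\<^sup>+x. (\<integral>\<^sup>+t. indicator (slab b) x * f (x + t *\<^sub>R b) \<partial>lborel) \<partial>lborel)"
    by (subst nn_integral_cmult) auto
  also have "\<dots> = (\<integral>\<^sup>+t. (\<integral>\<^sup>+x. indicator (slab b) x * f (x + t *\<^sub>R b) \<partial>lborel) \<partial>lborel)"
    by (rule pair_sigma_finite.Fubini') (auto intro!: pair_sigma_finite.intro lborel.sigma_finite_measure_axioms)
  also have "\<dots> = (\<integral>\<^sup>+t. (\<integral>\<^sup>+x. indicator {x \<bullet> b - 1..x \<bullet> b} t * f x \<partial>lborel) \<partial>lborel)"
  proof (rule nn_integral_cong)
    fix t :: real
    let ?g = "\<lambda>x. indicator {x \<bullet> b - 1..x \<bullet> b} t * f x"
    have 1: "?g = (\<lambda>x. indicator {x. x \<bullet> b - 1 \<le> t \<and> t \<le> x \<bullet> b} x * f x)"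
      by (auto simp: indicator_def)
    have "?g \<in> borel_measurable borel" unfolding 1 by measurable
    then have "(\<integral>\<^sup>+x. ?g x \<partial>lborel) = (\<integral>\<^sup>+x. ?g (x + t *\<^sub>R b) \<partial>lborel)"
      by (rule nn_integral_lborel_shift[symmetric])
    also have "\<dots> = (\<integral>\<^sup>+x. indicator (slab b) x * f (x + t *\<^sub>R b) \<partial>lborel)"
      by (rule nn_integral_cong) (auto simp: slab_def indicator_def inner_add_left bb)
    finally show "(\<integral>\<^sup>+x. indicator (slab b) x * f (x + t *\<^sub>R b) \<partial>lborel) = (\<integral>\<^sup>+x. ?g x \<partial>lborel)" ..
  qed
  also have "\<dots> = (\<integral>\<^sup>+x. (\<integral>\<^sup>+t. indicator {x \<bullet> b - 1..x \<bullet> b} t * f x \<partial>lborel) \<partial>lborel)"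
  proof (rule pair_sigma_finite.Fubini')
    have "(\<lambda>(x, t). indicator {x \<bullet> b - 1..x \<bullet> b} t * f x) =
      (\<lambda>p::'a\<times>real. indicator {p. fst p \<bullet> b - 1 \<le> snd p \<and> snd p \<le> fst p \<bullet> b} p * f (fst p))"
      by (auto simp: indicator_def)
    also have "\<dots> \<in> borel_measurable (lborel \<Otimes>\<^sub>M lborel)"
      by measurable
    finally show "(\<lambda>(x, t). indicator {x \<bullet> b - 1..x \<bullet> b} t * f x)
      \<in> borel_measurable (lborel \<Otimes>\<^sub>M (lborel :: real measure))" .
  qed (auto intro!: pair_sigma_finite.intro lborel.sigma_finite_measure_axioms)
  also have "\<dots> = (\<integral>\<^sup>+x. f x \<partial>lborel)"
    by (subst nn_integral_multc) auto
  finally show ?thesis .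
qed


text \<open>
  Markov's inequality for the length of the section of \<open>U\<close> by a line.
\<close>

lemma outer_measure_lines_le:
  fixes Z U :: "'a::euclidean_space set"
  assumes U: "U \<in> sets lebesgue" and b: "b \<in> Basis" and r: "0 < r" and Z: "Z \<subseteq> slab b"
    and seg: "\<And>x. x \<in> Z \<Longrightarrow> \<exists>u. \<forall>t\<in>{u<..<u + r}. x + t *\<^sub>R b \<in> U"
  shows "ennreal r * outer_measure_of lborel Z \<le> emeasure lebesgue U"
proof -
  obtain U' where UU': "U \<subseteq> U'" and "U' \<in> sets lborel"
    and eq: "emeasure lebesgue U = emeasure lborel U'"
    by (rule completion_upper[OF U])
  then have U'[measurable]: "U' \<in> sets borel" by simp
  define h where "h x = (\<integral>\<^sup>+t. indicator U' (x + t *\<^sub>R b) \<partial>lborel)" for x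
  have h[measurable]: "h \<in> borel_measurable borel"
    unfolding h_def by measurable
  define B where "B = {x \<in> slab b. ennreal r \<le> h x}"
  have B[measurable]: "B \<in> sets borel"
    unfolding B_def by measurable
  have ZB: "Z \<subseteq> B"
  proof
    fix x assume x: "x \<in> Z"
    obtain u where u: "\<forall>t\<in>{u<..<u + r}. x + t *\<^sub>R b \<in> U" using seg[OF x] by blast
    have "ennreal r = (\<integral>\<^sup>+t. indicator {u<..<u + r} t \<partial>lborel)" using r by simp
    also have "\<dots> \<le> h x" unfolding h_def
      by (rule nn_integral_mono) (use u UU' in \<open>auto simp: indicator_def\<close>)
    finally show "x \<in> B" using x Z by (auto simp: B_def)
  qed
  have "ennreal r * outer_measure_of lborel Z \<le> ennreal r * emeasure lborel B"
    using outer_measure_of_mono[OF ZB, of lborel] by (simp add: mult_left_mono)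
  also have "\<dots> = (\<integral>\<^sup>+x. ennreal r * indicator B x \<partial>lborel)"
    by (simp add: nn_integral_cmult_indicator)
  also have "\<dots> \<le> (\<integral>\<^sup>+x. indicator (slab b) x * h x \<partial>lborel)"
    by (rule nn_integral_mono) (auto simp: B_def indicator_def)
  also have "\<dots> = emeasure lborel U'"
    unfolding h_def by (subst nn_integral_lines[OF _ b]) auto
  finally show ?thesis using eq by simp
qed

lemma outer_measure_of_UN_le:
  assumes "finite J"
  shows "outer_measure_of M (\<Union>j\<in>J. A j) \<le> (\<Sum>j\<in>J. outer_measure_of M (A j))"
    (is "?L \<le> ?R")
proof (cases "\<forall>j\<in>J. A j \<subseteq> space M")
  case True
  then have "\<forall>j\<in>J. \<exists>E\<in>sets M. A j \<subseteq> E \<and> outer_measure_of M (A j) = emeasure M E"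
    by (auto intro!: outer_measure_of_attain)
  then obtain E where E: "\<And>j. j \<in> J \<Longrightarrow> E j \<in> sets M \<and> A j \<subseteq> E j \<and> outer_measure_of M (A j) = emeasure M (E j)"
    by metis
  have "?L \<le> outer_measure_of M (\<Union>j\<in>J. E j)"
    by (rule outer_measure_of_mono) (use E in blast)
  also have "\<dots> = emeasure M (\<Union>j\<in>J. E j)"
    by (rule outer_measure_of_eq) (use E assms in auto)
  also have "\<dots> \<le> (\<Sum>j\<in>J. emeasure M (E j))"
    by (rule emeasure_subadditive_finite) (use E assms in auto)
  also have "\<dots> = ?R" using E by simp
  finally show ?thesis .
next
  case False
  then obtain j where j: "j \<in> J" "\<not> A j \<subseteq> space M" by blast
  then have none: "{B \<in> sets M. A j \<subseteq> B} = {}" using sets.sets_into_space by blast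
  have "outer_measure_of M (A j) = \<infinity>" unfolding outer_measure_of_def none by simp
  then have "\<infinity> \<le> ?R"
    using assms j by (metis member_le_sum zero_le)
  then show ?thesis by (simp add: top_unique)
qed

lemma shadow_mono: "X \<subseteq> Y \<Longrightarrow> shadow b X \<subseteq> shadow b Y"
  by (auto simp: shadow_def)

lemma shadow_area_mono: "X \<subseteq> Y \<Longrightarrow> shadow_area X \<le> shadow_area Y"
  unfolding shadow_area_def by (intro sum_mono outer_measure_of_mono shadow_mono)

section \<open>The size of a set and of its shadows\<close>

text \<open>
  The integral of \<open>f\<close> over the affine subspace through \<open>x\<close> spanned by the directions in the list.
\<close>

fun line_integrals :: "'a::euclidean_space list \<Rightarrow> ('a \<Rightarrow> ennreal) \<Rightarrow> 'a \<Rightarrow> ennreal" where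
  "line_integrals [] f x = f x"
| "line_integrals (b # bs) f x = (\<integral>\<^sup>+t. line_integrals bs f (x + t *\<^sub>R b) \<partial>lborel)"

lemma line_integrals_measurable [measurable]:
  "f \<in> borel_measurable borel \<Longrightarrow> line_integrals bs f \<in> borel_measurable borel"
proof (induction bs)
  case Nil
  then show ?case by (simp add: fun_eq_iff[symmetric] cong: measurable_cong)
next
  case (Cons b bs)
  then have [measurable]: "line_integrals bs f \<in> borel_measurable borel" by simp
  show ?case unfolding line_integrals.simps[abs_def] by measurable
qed

lemma line_integrals_shift:
  assumes f: "f \<in> borel_measurable borel" and c: "c \<in> set bs"
  shows "line_integrals bs f (x + s *\<^sub>R c) = line_integrals bs f x"
  using c
proof (induction bs arbitrary: x)
  case (Cons b bs)
  note [measurable] = f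
  show ?case
  proof (cases "c = b")
    case True
    have "(\<integral>\<^sup>+t. line_integrals bs f (x + (t + s) *\<^sub>R b) \<partial>lborel)
      = (\<integral>\<^sup>+t. line_integrals bs f (x + t *\<^sub>R b) \<partial>lborel)"
      by (rule nn_integral_lborel_shift) measurable
    then show ?thesis using True by (simp add: algebra_simps)
  next
    case False
    then have "line_integrals bs f (x + t *\<^sub>R b + s *\<^sub>R c) = line_integrals bs f (x + t *\<^sub>R b)" for t
      using Cons by simp
    then show ?thesis by (simp add: add_ac)
  qed
qed simp

lemma line_integrals_const:
  fixes f :: "'a::euclidean_space \<Rightarrow> ennreal"
  assumes f: "f \<in> borel_measurable borel" and bs: "set bs = Basis"
  shows "line_integrals bs f x = line_integrals bs f y"
proof -
  have *: "line_integrals bs f (y + (\<Sum>b\<in>A. c b *\<^sub>R b)) = line_integrals bs f y"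
    if "finite A" "A \<subseteq> Basis" for A and c :: "'a \<Rightarrow> real"
    using that
  proof (induction A rule: finite_induct)
    case (insert b A)
    have "line_integrals bs f (y + (\<Sum>b\<in>insert b A. c b *\<^sub>R b)) =
      line_integrals bs f (y + (\<Sum>b\<in>A. c b *\<^sub>R b) + c b *\<^sub>R b)"
      using insert by (simp add: algebra_simps)
    also have "\<dots> = line_integrals bs f (y + (\<Sum>b\<in>A. c b *\<^sub>R b))"
      by (rule line_integrals_shift[OF f]) (use insert bs in auto)
    finally show ?case using insert by simp
  qed simp
  show ?thesis using *[of Basis "\<lambda>b. (x - y) \<bullet> b"] by (simp add: euclidean_representation)
qed

lemma nn_integral_line_integrals:
  assumes f: "f \<in> borel_measurable borel" and "set bs \<subseteq> Basis" "distinct bs"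
  shows "(\<integral>\<^sup>+x. indicator (\<Inter>b\<in>set bs. slab b) x * line_integrals bs f x \<partial>lborel)
    = (\<integral>\<^sup>+x. f x \<partial>lborel)"
  using assms(2,3)
proof (induction bs)
  case (Cons b bs)
  note [measurable] = f
  let ?S = "\<Inter>b\<in>set bs. slab b"
  have [measurable]: "?S \<in> sets borel" 
    by (cases "bs = []") (auto intro!: sets.finite_INT)
  let ?g = "\<lambda>x. indicator ?S x * line_integrals bs f x"
  have inv: "(x + t *\<^sub>R b \<in> ?S) = (x \<in> ?S)" for x t
  proof -
    have "(x + t *\<^sub>R b) \<bullet> c = x \<bullet> c" if "c \<in> set bs" for c
    proof -
      have "b \<noteq> c" "b \<in> Basis" "c \<in> Basis" using Cons.prems that by auto
      then show ?thesis by (simp add: inner_add_left inner_Basis)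
    qed
    then show ?thesis by (auto simp: slab_def)
  qed
  have "(\<integral>\<^sup>+x. indicator (\<Inter>b\<in>set (b # bs). slab b) x * line_integrals (b # bs) f x \<partial>lborel)
    = (\<integral>\<^sup>+x. indicator (slab b) x * (\<integral>\<^sup>+t. ?g (x + t *\<^sub>R b) \<partial>lborel) \<partial>lborel)"
  proof (rule nn_integral_cong)
    fix x :: 'a
    have "indicator (\<Inter>b\<in>set (b # bs). slab b) x = (indicator (slab b) x * indicator ?S x :: ennreal)"
      by (auto simp: indicator_def)
    moreover have "indicator ?S (x + t *\<^sub>R b) = (indicator ?S x :: ennreal)" for t
      using inv[of x t] by (auto simp: indicator_def)
    then have "(\<integral>\<^sup>+t. ?g (x + t *\<^sub>R b) \<partial>lborel)
      = (\<integral>\<^sup>+t. indicator ?S x * line_integrals bs f (x + t *\<^sub>R b) \<partial>lborel)"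
      by presburger
    moreover have "\<dots> = indicator ?S x * line_integrals (b # bs) f x"
      by (simp add: nn_integral_cmult)
    ultimately show "indicator (\<Inter>b\<in>set (b # bs). slab b) x * line_integrals (b # bs) f x
      = indicator (slab b) x * (\<integral>\<^sup>+t. ?g (x + t *\<^sub>R b) \<partial>lborel)"
      by (simp only: mult.assoc)
  qed
  also have "\<dots> = (\<integral>\<^sup>+x. ?g x \<partial>lborel)"
    by (rule nn_integral_lines) (use Cons in \<open>auto\<close>)
  finally show ?case using Cons by simp
qed simp

text \<open>
  Each step discards the points that lie on a short line section of what is left. A point that
  survives all steps starts a tree of long sections, one direction at a time, which sweeps out
  a large volume.
\<close>

fun trim :: "real \<Rightarrow> 'a::euclidean_space list \<Rightarrow> 'a set \<Rightarrow> 'a set" where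
  "trim l [] X = X"
| "trim l (b # bs) X =
    {x \<in> trim l bs X. ennreal l \<le> (\<integral>\<^sup>+t. indicator (trim l bs X) (x + t *\<^sub>R b) \<partial>lborel)}"

lemma trim_subset: "trim l bs X \<subseteq> X"
  by (induction bs) auto

lemma trim_measurable [measurable]: "X \<in> sets borel \<Longrightarrow> trim l bs X \<in> sets borel"
proof (induction bs)
  case (Cons b bs)
  then have [measurable]: "trim l bs X \<in> sets borel" by simp
  show ?case unfolding trim.simps by measurable
qed simp

lemma line_integrals_trim:
  assumes X: "X \<in> sets borel" and l: "0 \<le> l"
  shows "x \<in> trim l bs X \<Longrightarrow> ennreal (l ^ length bs) \<le> line_integrals bs (indicator X) x"
proof (induction bs arbitrary: x)
  case (Cons b bs)
  note [measurable] = X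
  let ?n = "length bs" and ?Y = "trim l bs X"
  have "ennreal (l ^ length (b # bs)) = ennreal (l ^ ?n) * ennreal l"
    using l by (simp add: ennreal_mult[symmetric] mult.commute)
  also have "\<dots> \<le> ennreal (l ^ ?n) * (\<integral>\<^sup>+t. indicator ?Y (x + t *\<^sub>R b) \<partial>lborel)"
    using Cons.prems by (auto intro!: mult_left_mono)
  also have "\<dots> = (\<integral>\<^sup>+t. ennreal (l ^ ?n) * indicator ?Y (x + t *\<^sub>R b) \<partial>lborel)"
    by (rule nn_integral_cmult[symmetric]) measurable
  also have "\<dots> \<le> (\<integral>\<^sup>+t. line_integrals bs (indicator X) (x + t *\<^sub>R b) \<partial>lborel)"
  proof (rule nn_integral_mono)
    show "ennreal (l ^ ?n) * indicator ?Y (x + t *\<^sub>R b) \<le> line_integrals bs (indicator X) (x + t *\<^sub>R b)" for t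
      using Cons.IH[of "x + t *\<^sub>R b"] by (cases "x + t *\<^sub>R b \<in> ?Y") auto
  qed
  finally show ?case by simp
qed simp

text \<open>
  The sections removed in direction \<open>b\<close> are shorter than \<open>l\<close> and lie over the shadow of \<open>X\<close>, so
  that little is lost when the shadows are small.
\<close>

lemma emeasure_trim:
  fixes X :: "'a::euclidean_space set"
  assumes X: "X \<in> sets borel" and "set bs \<subseteq> Basis" "distinct bs"
  shows "emeasure lborel X \<le> emeasure lborel (trim l bs X)
    + ennreal l * (\<Sum>b\<in>set bs. outer_measure_of lborel (shadow b X))"
  using assms(2,3)
proof (induction bs)
  case (Cons b bs)
  note [measurable] = X
  let ?Y = "trim l bs X" and ?Z = "trim l (b # bs) X"
  let ?h = "\<lambda>x. \<integral>\<^sup>+t. indicator ?Y (x + t *\<^sub>R b) \<partial>lborel"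
  have h: "?h (x + s *\<^sub>R b) = ?h x" for x s
    using nn_integral_lborel_shift[of "\<lambda>t. indicator ?Y (x + t *\<^sub>R b)" s]
    by (simp add: algebra_simps)
  obtain H where H[measurable]: "H \<in> sets borel" and sub: "shadow b X \<subseteq> H"
    and Heq: "outer_measure_of lborel (shadow b X) = emeasure lborel H"
    using outer_measure_of_attain[of "shadow b X" lborel] by auto
  have Zs: "?Z \<subseteq> ?Y" by auto
  have "emeasure lborel (?Y - ?Z) = (\<integral>\<^sup>+x. indicator (?Y - ?Z) x \<partial>lborel)"
    by simp
  also have "\<dots> = (\<integral>\<^sup>+x. indicator (slab b) x * (\<integral>\<^sup>+t. indicator (?Y - ?Z) (x + t *\<^sub>R b) \<partial>lborel) \<partial>lborel)"
    by (rule nn_integral_lines[symmetric]) (use Cons.prems X in \<open>auto simp del: trim.simps\<close>)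
  also have "\<dots> \<le> (\<integral>\<^sup>+x. ennreal l * indicator H x \<partial>lborel)"
  proof (rule nn_integral_mono)
    fix x :: 'a
    show "indicator (slab b) x * (\<integral>\<^sup>+t. indicator (?Y - ?Z) (x + t *\<^sub>R b) \<partial>lborel) \<le> ennreal l * indicator H x"
    proof (cases "x \<in> slab b \<and> (\<exists>s. x + s *\<^sub>R b \<in> ?Y - ?Z)")
      case True
      then obtain s where s: "x + s *\<^sub>R b \<in> ?Y - ?Z" by blast
      have "\<not> ennreal l \<le> ?h (x + s *\<^sub>R b)" using s by auto
      then have hl: "?h x \<le> ennreal l" by (simp add: h)
      have "x \<in> shadow b X" using True trim_subset by (fastforce simp: shadow_def)
      then have "x \<in> H" using sub by blast
      moreover have "(\<integral>\<^sup>+t. indicator (?Y - ?Z) (x + t *\<^sub>R b) \<partial>lborel) \<le> ?h x"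
        by (rule nn_integral_mono) (auto simp: indicator_def)
      ultimately show ?thesis using True hl by (simp del: trim.simps)
    next
      case False
      then have "x \<in> slab b \<Longrightarrow> (\<lambda>t. indicator (?Y - ?Z) (x + t *\<^sub>R b) :: ennreal) = (\<lambda>_. 0)"
        by (auto simp: indicator_def fun_eq_iff simp del: trim.simps)
      then show ?thesis by (cases "x \<in> slab b") (simp_all del: trim.simps)
    qed
  qed
  also have "\<dots> = ennreal l * outer_measure_of lborel (shadow b X)"
    by (simp add: Heq nn_integral_cmult)
  finally have diff: "emeasure lborel (?Y - ?Z) \<le> ennreal l * outer_measure_of lborel (shadow b X)" .
  have "emeasure lborel ?Y = emeasure lborel (?Z \<union> (?Y - ?Z))"
    using Zs by (simp add: Un_absorb1 del: trim.simps)
  also have "\<dots> = emeasure lborel ?Z + emeasure lborel (?Y - ?Z)"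
    by (rule plus_emeasure[symmetric]) (use X in \<open>auto simp del: trim.simps\<close>)
  finally have "emeasure lborel ?Y \<le> emeasure lborel ?Z + ennreal l * outer_measure_of lborel (shadow b X)"
    using diff by (simp add: add_left_mono del: trim.simps)
  then have "emeasure lborel X \<le> emeasure lborel ?Z + ennreal l * outer_measure_of lborel (shadow b X)
     + ennreal l * (\<Sum>b\<in>set bs. outer_measure_of lborel (shadow b X))"
    using Cons by (meson add_right_mono distinct.simps(2) list.set_intros(2) order_trans subset_iff)
  then show ?case using Cons.prems
    by (simp add: distrib_left add.assoc del: trim.simps)
qed simp

text \<open>
  If the shadows are so small that trimming leaves a point \<open>x0\<close>, then the iterated integral of
  the indicator function at \<open>x0\<close> is at least \<open>l ^ DIM('a)\<close>. Taken over all directions, that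
  integral does not depend on the base point and is the measure of \<open>X\<close>.
\<close>

lemma loomis_whitney_power:
  fixes X :: "'a::euclidean_space set"
  assumes X: "X \<in> sets lebesgue" and l: "0 \<le> l"
    and less: "ennreal l * shadow_area X < emeasure lebesgue X"
  shows "ennreal (l ^ DIM('a)) \<le> emeasure lebesgue X"
proof -
  define Y where "Y = main_part lborel X"
  have Y: "Y \<in> sets borel" "Y \<subseteq> X" "emeasure lebesgue X = emeasure lborel Y"
    using main_part_sets[OF X] main_part_null_part_Un[OF X] emeasure_completion[OF X]
    unfolding Y_def by auto
  obtain bs :: "'a list" where bs: "set bs = Basis" "distinct bs"
    using finite_distinct_list[OF finite_Basis] by blast
  have len: "length bs = DIM('a)" using bs distinct_card by fastforce
  have "ennreal l * (\<Sum>b\<in>set bs. outer_measure_of lborel (shadow b Y)) < emeasure lborel Y"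
    using less mult_left_mono[OF shadow_area_mono[OF Y(2)], of "ennreal l"] Y(3)
    by (simp add: bs(1) shadow_area_def)
  then have "trim l bs Y \<noteq> {}"
    using emeasure_trim[OF Y(1), of bs l] bs by (auto simp: not_le[symmetric])
  then obtain x0 where x0: "x0 \<in> trim l bs Y" by blast
  let ?c = "line_integrals bs (indicator Y) x0"
  have ge: "ennreal (l ^ DIM('a)) \<le> ?c"
    using line_integrals_trim[OF Y(1) l x0] len by simp
  have cube: "(\<Inter>b\<in>Basis. slab b) = (cbox 0 One :: 'a set)"
    by (auto simp: slab_def mem_box)
  have "emeasure lborel Y = (\<integral>\<^sup>+x. indicator Y x \<partial>lborel)" using Y by simp
  also have "\<dots> = (\<integral>\<^sup>+x. indicator (\<Inter>b\<in>set bs. slab b) x * line_integrals bs (indicator Y) x \<partial>lborel)"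
    by (rule nn_integral_line_integrals[symmetric]) (use bs Y in auto)
  also have "\<dots> = (\<integral>\<^sup>+x. ?c * indicator (cbox 0 One) (x::'a) \<partial>lborel)"
  proof (rule nn_integral_cong)
    fix x :: 'a
    have "line_integrals bs (indicator Y) x = ?c"
      by (rule line_integrals_const) (use bs Y in auto)
    then show "indicator (\<Inter>b\<in>set bs. slab b) x * line_integrals bs (indicator Y) x
      = ?c * indicator (cbox 0 One) x"
      by (simp add: bs(1) cube mult.commute)
  qed
  also have "\<dots> = ?c * emeasure lborel (cbox 0 (One::'a))"
    by (simp add: nn_integral_cmult)
  also have "emeasure lborel (cbox 0 (One::'a)) = 1"
    by (simp add: emeasure_lborel_cbox_eq)
  finally show ?thesis using ge Y by simp
qed


text \<open>
  A form of the Loomis--Whitney inequality, with the sum of the shadows in place of their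
  geometric mean: for a set of measure \<open>V\<close> it says \<open>V powr ((d - 1) / d) \<le> p\<close>.
\<close>

lemma loomis_whitney:
  fixes X :: "'a::euclidean_space set"
  assumes X: "X \<in> lmeasurable" and p: "0 \<le> p" "shadow_area X = ennreal p"
  shows "measure lebesgue X \<le> p * root DIM('a) (measure lebesgue X)"
proof (rule ccontr)
  let ?V = "measure lebesgue X" and ?d = "DIM('a)"
  assume "\<not> ?thesis"
  then have less: "p * root ?d ?V < ?V" by simp
  define e where "e = (?V - p * root ?d ?V) / (p + 1)"
  have e: "0 < e" using less p by (simp add: e_def)
  define l where "l = root ?d ?V + e"
  have l0: "0 \<le> root ?d ?V" by simp
  then have l: "0 \<le> l" "root ?d ?V < l" using e by (auto simp: l_def)
  have "p * e < (p + 1) * e" using e by simp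
  also have "\<dots> = ?V - p * root ?d ?V" using p by (simp add: e_def)
  finally have "l * p < ?V" by (simp add: l_def algebra_simps)
  then have "ennreal l * shadow_area X < emeasure lebesgue X"
    using X l p by (simp add: emeasure_eq_measure2 ennreal_mult[symmetric] ennreal_less_iff)
  then have "ennreal (l ^ ?d) \<le> emeasure lebesgue X"
    using X l by (intro loomis_whitney_power) auto
  then have "l ^ ?d \<le> ?V" using X by (simp add: emeasure_eq_measure2)
  moreover have "?V < l ^ ?d"
    using power_strict_mono[OF l(2) l0, of ?d] by simp
  ultimately show False by simp
qed

lemma shadow_area_thickened:
  fixes X U :: "'a::euclidean_space set"
  assumes U: "U \<in> sets lebesgue" and r: "0 < r" and sub: "\<And>x. x \<in> X \<Longrightarrow> ball x r \<subseteq> U"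
  shows "ennreal r * shadow_area X \<le> of_nat DIM('a) * emeasure lebesgue U"
proof -
  have "ennreal r * outer_measure_of lborel (shadow b X) \<le> emeasure lebesgue U" if b: "b \<in> Basis" for b
  proof (rule outer_measure_lines_le[OF U b r])
    show "shadow b X \<subseteq> slab b" by (auto simp: shadow_def)
    fix x assume "x \<in> shadow b X"
    then obtain t where t: "x + t *\<^sub>R b \<in> X" by (auto simp: shadow_def)
    have "x + s *\<^sub>R b \<in> U" if "s \<in> {t<..<t + r}" for s
    proof -
      have "dist (x + t *\<^sub>R b) (x + s *\<^sub>R b) = norm ((t - s) *\<^sub>R b)"
        by (simp add: dist_norm algebra_simps)
      also have "\<dots> < r" using that b by simp
      finally show ?thesis using sub[OF t] by auto
    qed
    then show "\<exists>u. \<forall>t\<in>{u<..<u + r}. x + t *\<^sub>R b \<in> U" by blast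
  qed
  then have "(\<Sum>b\<in>Basis. ennreal r * outer_measure_of lborel (shadow b X)) \<le> (\<Sum>b\<in>(Basis::'a set). emeasure lebesgue U)"
    by (rule sum_mono)
  then show ?thesis by (simp add: shadow_area_def sum_distrib_left)
qed

section \<open>Covering an annulus\<close>

text \<open>
  A line that meets the bounded set \<open>E\<close> contains, just beyond the supremum of its points in \<open>E\<close>,
  a segment of length \<open>r\<close> inside the annulus. So either the line meets one of the sets \<open>S j\<close>, or it has a
  section of length at least \<open>r\<close> in \<open>G\<close>. This is the isoperimetric input of the proof: few sets
  with small shadows cannot cover the annulus.
\<close>

lemma shadow_area_annulus:
  fixes A E G :: "'a::euclidean_space set"
  assumes E: "bounded E" "A \<subseteq> E" and r: "0 < r" and G: "G \<in> sets lebesgue" and fin: "finite J"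
    and cover: "(\<Union>y\<in>E. ball y r) - E \<subseteq> G \<union> (\<Union>j\<in>J. S j)"
  shows "ennreal r * shadow_area A \<le> ennreal r * (\<Sum>j\<in>J. shadow_area (S j))
    + of_nat DIM('a) * emeasure lebesgue G"
proof -
  have *: "ennreal r * outer_measure_of lborel (shadow b A)
    \<le> ennreal r * (\<Sum>j\<in>J. outer_measure_of lborel (shadow b (S j))) + emeasure lebesgue G"
    if b: "b \<in> Basis" for b
  proof -
    define Z where "Z = shadow b A - (\<Union>j\<in>J. shadow b (S j))"
    have "ennreal r * outer_measure_of lborel Z \<le> emeasure lebesgue G"
    proof (rule outer_measure_lines_le[OF G b r])
      show "Z \<subseteq> slab b" by (auto simp: Z_def shadow_def)
      fix x assume x: "x \<in> Z"
      define P where "P = {t. x + t *\<^sub>R b \<in> E}"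
      have ne: "P \<noteq> {}" using x E(2) by (auto simp: Z_def P_def shadow_def)
      obtain B where B: "\<And>y. y \<in> E \<Longrightarrow> norm y \<le> B" using E(1) by (auto simp: bounded_iff)
      have "t \<le> B + norm x" if "t \<in> P" for t
      proof -
        have "\<bar>t\<bar> = norm (t *\<^sub>R b)" using b by simp
        also have "\<dots> = norm ((x + t *\<^sub>R b) - x)" by simp
        also have "\<dots> \<le> norm (x + t *\<^sub>R b) + norm x" by (rule norm_triangle_ineq4)
        finally show ?thesis using B that by (fastforce simp: P_def)
      qed
      then have bdd: "bdd_above P" by (auto simp: bdd_above_def)
      define u where "u = Sup P"
      have "x + t *\<^sub>R b \<in> G" if t: "t \<in> {u<..<u + r}" for t
      proof -
        have "t \<notin> P" using t cSup_upper[OF _ bdd] by (fastforce simp: u_def)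
        then have notE: "x + t *\<^sub>R b \<notin> E" by (simp add: P_def)
        have "t - r < Sup P" using t by (simp add: u_def)
        then obtain s where s: "s \<in> P" "t - r < s" using less_cSup_iff[OF ne bdd] by blast
        have "s \<le> u" using cSup_upper[OF s(1) bdd] by (simp add: u_def)
        have "dist (x + s *\<^sub>R b) (x + t *\<^sub>R b) = norm ((s - t) *\<^sub>R b)"
          by (simp add: dist_norm algebra_simps)
        also have "\<dots> < r" using s \<open>s \<le> u\<close> t b by simp
        finally have "x + t *\<^sub>R b \<in> ball (x + s *\<^sub>R b) r" by simp
        moreover have "x + s *\<^sub>R b \<in> E" using s(1) by (simp add: P_def)
        ultimately have "x + t *\<^sub>R b \<in> (\<Union>y\<in>E. ball y r) - E" using notE by blast
        moreover have "x + t *\<^sub>R b \<notin> S j" if "j \<in> J" for j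
          using x that by (auto simp: Z_def shadow_def)
        ultimately show ?thesis using cover by blast
      qed
      then show "\<exists>u. \<forall>t\<in>{u<..<u + r}. x + t *\<^sub>R b \<in> G" by blast
    qed
    moreover have "outer_measure_of lborel (shadow b A)
      \<le> (\<Sum>j\<in>J. outer_measure_of lborel (shadow b (S j))) + outer_measure_of lborel Z"
    proof -
      let ?A = "case_option Z (\<lambda>j. shadow b (S j))" and ?J = "insert None (Some ` J)"
      have "outer_measure_of lborel (shadow b A) \<le> outer_measure_of lborel (\<Union>i\<in>?J. ?A i)"
        by (rule outer_measure_of_mono) (auto simp: Z_def)
      also have "\<dots> \<le> (\<Sum>i\<in>?J. outer_measure_of lborel (?A i))"
        by (rule outer_measure_of_UN_le) (use fin in simp)
      also have "\<dots> = outer_measure_of lborel Z + (\<Sum>j\<in>J. outer_measure_of lborel (shadow b (S j)))"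
        using fin by (subst sum.insert) (auto simp: sum.reindex)
      finally show ?thesis by (simp add: add.commute)
    qed
    then have "ennreal r * outer_measure_of lborel (shadow b A)
      \<le> ennreal r * (\<Sum>j\<in>J. outer_measure_of lborel (shadow b (S j))) + ennreal r * outer_measure_of lborel Z"
      by (metis distrib_left mult_left_mono zero_le)
    ultimately show ?thesis by (meson add_left_mono order_trans)
  qed
  have "ennreal r * shadow_area A = (\<Sum>b\<in>Basis. ennreal r * outer_measure_of lborel (shadow b A))"
    by (simp add: shadow_area_def sum_distrib_left)
  also have "\<dots> \<le> (\<Sum>b\<in>Basis. ennreal r * (\<Sum>j\<in>J. outer_measure_of lborel (shadow b (S j))) + emeasure lebesgue G)"
    by (rule sum_mono) (rule *)
  also have "\<dots> = ennreal r * (\<Sum>b\<in>Basis. \<Sum>j\<in>J. outer_measure_of lborel (shadow b (S j)))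
      + of_nat DIM('a) * emeasure lebesgue G"
    by (simp add: sum.distrib sum_distrib_left)
  also have "(\<Sum>b\<in>Basis. \<Sum>j\<in>J. outer_measure_of lborel (shadow b (S j))) = (\<Sum>j\<in>J. shadow_area (S j))"
    unfolding shadow_area_def by (rule sum.swap)
  finally show ?thesis .
qed

section \<open>Chains of scales\<close>

lemma doubling_le_power:
  fixes a :: "nat \<Rightarrow> real"
  assumes "\<And>n. n0 \<le> n \<Longrightarrow> a (Suc n) \<le> 2 * a n" and n: "n0 \<le> n"
  shows "a (n + i) \<le> 2 ^ i * a n"
proof (induction i)
  case (Suc i)
  have "a (n + Suc i) \<le> 2 * a (n + i)" using assms(1)[of "n + i"] n by simp
  then show ?case using Suc by simp
qed simp

lemma doubling_sum_le:
  fixes a :: "nat \<Rightarrow> real"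
  assumes dbl: "\<And>n. n0 \<le> n \<Longrightarrow> a (Suc n) \<le> 2 * a n" and n: "n0 \<le> n" and pos: "0 \<le> a n"
  shows "(\<Sum>i\<in>{n..<n + s}. a i) \<le> real s * 2 ^ s * a n"
proof -
  have "(\<Sum>i\<in>{n..<n + s}. a i) \<le> (\<Sum>i\<in>{n..<n + s}. 2 ^ s * a n)"
  proof (rule sum_mono)
    fix i assume i: "i \<in> {n..<n + s}"
    have "a i \<le> 2 ^ (i - n) * a n" using doubling_le_power[of n0 a n "i - n"] dbl n i by simp
    also have "\<dots> \<le> 2 ^ s * a n"
      using i pos by (intro mult_right_mono power_increasing) auto
    finally show "a i \<le> 2 ^ s * a n" .
  qed
  then show ?thesis by simp
qed

text \<open>
  Suppose the claim fails. From a scale \<open>n\<close> pass to the block of scales beyond \<open>n + s\<close> in which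
  \<open>a\<close> sums to about \<open>4 * H * a n\<close>. As the defect term is too small, \<open>step\<close> gives
  \<open>T n < 2 * w n m * T m\<close> for all \<open>m\<close> in that block. Since the weights \<open>w n m\<close> sum to at most \<open>H\<close>,
  some \<open>m\<close> there carries a weight that is small in proportion to \<open>a m\<close>, and for this \<open>m\<close> the
  product \<open>T m * a m\<close> is at least twice \<open>T n * a n\<close>. Repeating this violates the bound \<open>K\<close>. Because
  both \<open>T\<close> and \<open>T * a\<close> grow along the chain, the sum of \<open>a\<close> over all blocks passed is dominated
  by the last term; therefore the constant in the conclusion does not depend on \<open>K\<close>.
\<close>

lemma chain_block:
  fixes a T g :: "nat \<Rightarrow> real" and w :: "nat \<Rightarrow> nat \<Rightarrow> real"
  assumes pos: "\<And>n. n0 \<le> n \<Longrightarrow> 0 < a n"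
    and dbl: "\<And>n. n0 \<le> n \<Longrightarrow> a (Suc n) \<le> 2 * a n"
    and unbounded: "\<And>B. \<exists>M. B \<le> (\<Sum>n\<in>{n0..<M}. a n)"
    and w_nonneg: "\<And>n m. n0 \<le> n \<Longrightarrow> n \<le> m \<Longrightarrow> 0 \<le> w n m"
    and w_small: "\<And>n m. n0 \<le> n \<Longrightarrow> n + s \<le> m \<Longrightarrow> w n m \<le> 1 / 4"
    and w_sum: "\<And>n M. n0 \<le> n \<Longrightarrow> (\<Sum>m\<in>{n..<M}. w n m) \<le> H" and H: "0 < H"
    and T0: "0 < T n0" and T_bound: "\<And>m. n0 \<le> m \<Longrightarrow> T m * a m \<le> K"
    and g_mono: "\<And>m m'. n0 \<le> m \<Longrightarrow> m \<le> m' \<Longrightarrow> g m \<le> g m'"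
    and step: "\<And>n m. n0 \<le> n \<Longrightarrow> n + s \<le> m \<Longrightarrow> T n \<le> w n m * T m + c * g m / a n"
    and c: "0 < c" and s: "1 \<le> s"
  shows "\<exists>e>n0. T n0 * (\<Sum>n\<in>{n0..<e}. a n) \<le> 4 * (real (s + 1) * 2 ^ s + 12 * H) * c * g e"
proof (rule ccontr)
  define Q where "Q = real (s + 1) * 2 ^ s + 12 * H"
  have Q0: "0 < Q" using H by (simp add: Q_def add_pos_pos)
  assume "\<not> ?thesis"
  then have no: "4 * Q * c * g e < T n0 * (\<Sum>n\<in>{n0..<e}. a n)" if "n0 < e" for e
    using that by (auto simp: Q_def not_le)
  define inv where "inv i n \<longleftrightarrow> n0 \<le> n \<and> T n0 \<le> T n \<and>
    T n0 * (\<Sum>n\<in>{n0..<n}. a n) \<le> Q * (T n * a n) \<and> 2 ^ i * (T n0 * a n0) \<le> T n * a n" for i :: nat and n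
  have next_link: "\<exists>m. inv (Suc i) m" if I: "inv i n" for i n
  proof -
    have n: "n0 \<le> n" and Tn: "T n0 \<le> T n" and sumn: "T n0 * (\<Sum>n\<in>{n0..<n}. a n) \<le> Q * (T n * a n)"
      and pown: "2 ^ i * (T n0 * a n0) \<le> T n * a n" using I by (auto simp: inv_def)
    have an: "0 < a n" using pos n by simp
    \<comment> \<open>the shortest block \<open>[p, e)\<close> beyond \<open>n + s\<close> whose sum is large against \<open>a n\<close>\<close>
    define p where "p = n + s"
    define big where "big e \<longleftrightarrow> p < e \<and> 4 * H * a n \<le> (\<Sum>m\<in>{p..<e}. a m)" for e
    obtain M where M: "(\<Sum>n\<in>{n0..<p}. a n) + 4 * H * a n \<le> (\<Sum>n\<in>{n0..<M}. a n)"
      using unbounded by blast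
    have "p < M"
    proof (rule ccontr)
      assume "\<not> p < M"
      then have "(\<Sum>n\<in>{n0..<M}. a n) \<le> (\<Sum>n\<in>{n0..<p}. a n)"
        by (intro sum_mono2) (auto intro: less_imp_le[OF pos])
      moreover have "0 < 4 * H * a n" using H an by simp
      ultimately show False using M by linarith
    qed
    moreover have "(\<Sum>n\<in>{n0..<M}. a n) = (\<Sum>n\<in>{n0..<p}. a n) + (\<Sum>n\<in>{p..<M}. a n)"
      using \<open>p < M\<close> n by (intro sum.atLeastLessThan_concat[symmetric]) (auto simp: p_def)
    ultimately have "big M" using M by (simp add: big_def)
    define e where "e = (LEAST e. big e)"
    have "big e" using LeastI[of big M] \<open>big M\<close> by (simp add: e_def)
    then have pe: "p < e" and S: "4 * H * a n \<le> (\<Sum>m\<in>{p..<e}. a m)" by (auto simp: big_def)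
    define S where "S = (\<Sum>m\<in>{p..<e}. a m)"
    have S0: "0 < S" using S H an by (simp add: S_def) (smt (verit) mult_pos_pos)
    have S_le: "S \<le> (2 ^ s + 12 * H) * a n"
    proof (cases "e = Suc p")
      case True
      have "S = a (n + s)" by (simp add: S_def True p_def)
      also have "\<dots> \<le> 2 ^ s * a n" using doubling_le_power[of n0 a n s] dbl n by simp
      also have "\<dots> \<le> (2 ^ s + 12 * H) * a n" using H an by simp
      finally show ?thesis .
    next
      case False
      then obtain e' where e': "e = Suc (Suc e')" "p \<le> e'"
        using pe that[of "e - 2"] by fastforce
      have "\<not> big (Suc e')" using not_less_Least[of "Suc e'" big] e' by (simp add: e_def[symmetric])
      then have small: "(\<Sum>m\<in>{p..<Suc e'}. a m) < 4 * H * a n" using e' by (simp add: big_def)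
      have "n0 \<le> e'" using e' n by (simp add: p_def)
      have "a e' \<le> (\<Sum>m\<in>{p..<Suc e'}. a m)"
        using e' n by (intro member_le_sum) (auto intro!: less_imp_le[OF pos] simp: p_def)
      moreover have "a (Suc e') \<le> 2 * a e'" using dbl \<open>n0 \<le> e'\<close> by simp
      moreover have "S = (\<Sum>m\<in>{p..<Suc e'}. a m) + a (Suc e')"
        using e' by (simp add: S_def)
      ultimately have "S \<le> 12 * H * a n" using small by simp
      also have "\<dots> \<le> (2 ^ s + 12 * H) * a n" using an by simp
      finally show ?thesis .
    qed
    have "(\<Sum>m\<in>{n..<e}. a m) = (\<Sum>m\<in>{n..<n + s}. a m) + S"
      unfolding S_def p_def[symmetric] using pe
      by (intro sum.atLeastLessThan_concat[symmetric]) (auto simp: p_def)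
    also have "\<dots> \<le> real s * 2 ^ s * a n + (2 ^ s + 12 * H) * a n"
      using doubling_sum_le[of n0 a n s] dbl n an S_le by simp
    also have "\<dots> = Q * a n" by (simp add: Q_def algebra_simps)
    finally have block: "(\<Sum>m\<in>{n..<e}. a m) \<le> Q * a n" .
    have concat: "(\<Sum>m\<in>{n0..<m}. a m) = (\<Sum>m\<in>{n0..<n}. a m) + (\<Sum>m\<in>{n..<m}. a m)" if "n \<le> m" for m
      using that n by (intro sum.atLeastLessThan_concat[symmetric]) auto
    \<comment> \<open>the sum over everything passed so far is still controlled by the current link\<close>
    have T_block: "T n0 * (\<Sum>m\<in>{n0..<e}. a m) \<le> 2 * Q * (T n * a n)"
    proof -
      have "T n0 * (\<Sum>m\<in>{n..<e}. a m) \<le> T n * (Q * a n)"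
        using block T0 Tn Q0 an pos n by (intro mult_mono) (auto intro!: sum_nonneg less_imp_le[OF pos])
      then show ?thesis using sumn concat[of e] pe by (simp add: p_def algebra_simps)
    qed
    have loss: "c * g e / a n < T n / 2"
    proof -
      have "n0 < e" using pe n by (simp add: p_def)
      then have "4 * Q * c * g e < 2 * Q * (T n * a n)" using no T_block by force
      then have "Q * (2 * c * g e) < Q * (T n * a n)" by (simp add: algebra_simps)
      then have "2 * c * g e < T n * a n" using Q0 by simp
      then show ?thesis using an by (simp add: field_simps)
    qed
    have gain: "T n / 2 < w n m * T m" if m: "m \<in> {p..<e}" for m
    proof -
      have "T n \<le> w n m * T m + c * g m / a n" using step n m by (simp add: p_def)
      moreover have "c * g m / a n \<le> c * g e / a n"
        using g_mono[of m e] m n c an by (intro divide_right_mono mult_left_mono) (auto simp: p_def)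
      ultimately show ?thesis using loss by linarith
    qed
    \<comment> \<open>the weights sum to at most \<open>H\<close>, the numbers \<open>H * a m / S\<close> to exactly \<open>H\<close>\<close>
    obtain m where m: "m \<in> {p..<e}" and wm: "w n m \<le> H * a m / S"
    proof (rule ccontr)
      assume "\<not> thesis"
      then have "\<forall>m\<in>{p..<e}. H * a m / S < w n m" using that by (meson not_le)
      then have "(\<Sum>m\<in>{p..<e}. H * a m / S) < (\<Sum>m\<in>{p..<e}. w n m)"
        using pe by (intro sum_strict_mono) auto
      moreover have "(\<Sum>m\<in>{p..<e}. H * a m / S) = H"
        using S0 by (simp add: S_def sum_divide_distrib[symmetric] sum_distrib_left[symmetric])
      moreover have "(\<Sum>m\<in>{p..<e}. w n m) \<le> (\<Sum>m\<in>{n..<e}. w n m)"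
        using n by (intro sum_mono2) (auto simp: p_def intro: w_nonneg)
      ultimately show False using w_sum[OF n, of e] by linarith
    qed
    have nm: "n \<le> m" "n0 \<le> m" and am: "0 < a m" using m n pos by (auto simp: p_def)
    have Tn0: "0 < T n" using T0 Tn by simp
    have wn: "0 \<le> w n m" "w n m \<le> 1 / 4" using w_nonneg w_small m n by (auto simp: p_def)
    have "0 < w n m * T m" using gain[OF m] Tn0 by linarith
    then have Tm0: "0 < T m" using wn(1) by (simp add: zero_less_mult_iff)
    have "T n / 2 < 1 / 4 * T m"
      using gain[OF m] mult_right_mono[OF wn(2), of "T m"] Tm0 by linarith
    then have Tnm: "T n \<le> T m" using Tn0 by simp
    have "T n / 2 < H * a m / S * T m"
      using gain[OF m] mult_right_mono[OF wm, of "T m"] Tm0 by linarith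
    then have "T n * S < 2 * H * (T m * a m)" using S0 by (simp add: field_simps)
    moreover have "T n * (4 * H * a n) \<le> T n * S" using S Tn0 by (simp add: S_def)
    ultimately have "2 * H * (2 * (T n * a n)) < 2 * H * (T m * a m)"
      by (simp add: algebra_simps)
    then have dblT: "2 * (T n * a n) < T m * a m" using H by simp
    have "T n0 * (\<Sum>m\<in>{n0..<m}. a m) \<le> T n0 * (\<Sum>m\<in>{n0..<e}. a m)"
      using T0 m by (intro mult_left_mono sum_mono2) (auto intro!: less_imp_le[OF pos])
    also have "\<dots> \<le> Q * (2 * (T n * a n))" using T_block by simp
    also have "\<dots> \<le> Q * (T m * a m)" using dblT Q0 by simp
    finally have "inv (Suc i) m"
      using nm Tn Tnm pown dblT by (simp add: inv_def)
    then show ?thesis ..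
  qed
  have "\<exists>n. inv i n" for i
  proof (induction i)
    case 0
    have "inv 0 n0" using T0 pos[of n0] Q0 by (simp add: inv_def)
    then show ?case ..
  qed (use next_link in blast)
  then have "2 ^ i * (T n0 * a n0) \<le> K" for i :: nat
    using T_bound by (meson inv_def order_trans)
  moreover obtain i :: nat where i: "K / (T n0 * a n0) < 2 ^ i"
    using real_arch_pow[of 2 "K / (T n0 * a n0)"] by auto
  have "0 < T n0 * a n0" using T0 pos by simp
  then have "K < 2 ^ i * (T n0 * a n0)" using i pos_divide_less_eq by blast
  ultimately show False by (meson not_le)
qed

lemma power_diff_le:
  fixes x z :: real
  assumes "0 \<le> z" "z \<le> x"
  shows "x ^ Suc k - z ^ Suc k \<le> real (Suc k) * x ^ k * (x - z)"
proof (induction k)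
  case (Suc k)
  have "x ^ Suc (Suc k) - z ^ Suc (Suc k) = x * (x ^ Suc k - z ^ Suc k) + z ^ Suc k * (x - z)"
    by (simp add: algebra_simps)
  also have "\<dots> \<le> x * (real (Suc k) * x ^ k * (x - z)) + x ^ Suc k * (x - z)"
    using assms Suc by (intro add_mono mult_left_mono mult_right_mono power_mono) auto
  also have "\<dots> = real (Suc (Suc k)) * x ^ Suc k * (x - z)"
    by (simp add: algebra_simps)
  finally show ?case .
qed simp

text \<open>
  A discrete form of the differential inequality that turns \<open>-(x\<^sup>d)' \<ge> c x\<^sup>d\<^sup>-\<^sup>1 S\<close> into
  \<open>-x' \<ge> c' S\<close>.
\<close>

lemma root_difference_bound:
  fixes x z w S A :: real
  assumes "0 \<le> z" "z \<le> x" "0 < x" "x / 2 \<le> w" "0 \<le> S" "0 \<le> A"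
    and "w ^ k * S \<le> A * (x ^ Suc k - z ^ Suc k)"
  shows "S \<le> A * real (Suc k) * 2 ^ k * (x - z)"
proof -
  have "x ^ k * S = 2 ^ k * ((x / 2) ^ k * S)" by (simp add: power_divide)
  also have "\<dots> \<le> 2 ^ k * (w ^ k * S)"
    using assms by (intro mult_left_mono mult_right_mono power_mono) auto
  also have "\<dots> \<le> 2 ^ k * (A * (x ^ Suc k - z ^ Suc k))" using assms by simp
  also have "\<dots> \<le> 2 ^ k * (A * (real (Suc k) * x ^ k * (x - z)))"
    using assms power_diff_le[of z x k] by (intro mult_left_mono) auto
  also have "\<dots> = x ^ k * (A * real (Suc k) * 2 ^ k * (x - z))" by simp
  finally show ?thesis using assms by simp
qed

text \<open>
  The blocks \<open>[l + q, e + q)\<close> can be chained without gaps or overlaps, and then the right-hand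
  sides telescope.
\<close>

lemma summable_if_block_sums_telescope:
  fixes a y :: "nat \<Rightarrow> real"
  assumes a: "\<And>n. 1 \<le> n \<Longrightarrow> 0 \<le> a n" and y: "\<And>n. 0 \<le> y n" and A: "0 \<le> A"
    and block: "\<And>l. 1 \<le> l \<Longrightarrow> \<exists>e>l. (\<Sum>n\<in>{l + q..<e + q}. a n) \<le> A * (y l - y e)"
  shows "summable a"
proof -
  have "\<exists>e>j. (\<Sum>n\<in>{1 + q..<e + q}. a n) \<le> A * (y 1 - y e)" for j
  proof (induction j)
    case 0
    then show ?case using block[of 1] by auto
  next
    case (Suc j)
    then obtain l where l: "j < l" "(\<Sum>n\<in>{1 + q..<l + q}. a n) \<le> A * (y 1 - y l)" by blast
    obtain e where e: "l < e" "(\<Sum>n\<in>{l + q..<e + q}. a n) \<le> A * (y l - y e)"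
      using block[of l] l by auto
    have "(\<Sum>n\<in>{1 + q..<e + q}. a n) = (\<Sum>n\<in>{1 + q..<l + q}. a n) + (\<Sum>n\<in>{l + q..<e + q}. a n)"
      using l e by (intro sum.atLeastLessThan_concat[symmetric]) auto
    also have "\<dots> \<le> A * (y 1 - y e)" using l e by (simp add: algebra_simps)
    finally show ?case using l e by (intro exI[of _ e]) auto
  qed
  note prefix_sums = this
  have bd: "(\<Sum>n\<in>{1 + q..<j + (1 + q)}. a n) \<le> A * y 1" for j
  proof -
    obtain e where e: "j < e" "(\<Sum>n\<in>{1 + q..<e + q}. a n) \<le> A * (y 1 - y e)"
      using prefix_sums by blast
    have "(\<Sum>n\<in>{1 + q..<j + (1 + q)}. a n) \<le> (\<Sum>n\<in>{1 + q..<e + q}. a n)"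
      using e a by (intro sum_mono2) auto
    also have "\<dots> \<le> A * y 1" using e(2) A y[of e] by (smt (verit) mult_left_mono)
    finally show ?thesis .
  qed
  have "(\<Sum>i<j. a (i + (1 + q))) \<le> A * y 1" for j
  proof -
    have "(\<Sum>i<j. a (i + (1 + q))) = (\<Sum>n\<in>{0 + (1 + q)..<j + (1 + q)}. a n)"
      by (subst sum.shift_bounds_nat_ivl) (simp add: lessThan_atLeast0)
    then show ?thesis using bd by simp
  qed
  then have "summable (\<lambda>i. a (i + (1 + q)))"
    using a by (intro summableI_nonneg_bounded) auto
  then show ?thesis by (rule summable_iff_shift[THEN iffD1])
qed

section \<open>Gaps and shadows in an admissible system\<close>

definition shadow_size :: "'a::euclidean_space set \<Rightarrow> real" where
  "shadow_size X = enn2real (shadow_area X)"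

lemma nbhd_open: "open (nbhd X r)"
  by (auto simp: nbhd_def)

lemma nbhd_bounded:
  fixes X :: "'a::euclidean_space set"
  assumes "bounded X" shows "bounded (nbhd X r)"
proof -
  obtain B where B: "\<And>x. x \<in> X \<Longrightarrow> norm x \<le> B" using assms by (auto simp: bounded_iff)
  have "norm z \<le> B + r" if z: "z \<in> nbhd X r" for z
  proof -
    obtain y where y: "y \<in> X" "dist y z < r" using z by (auto simp: nbhd_def)
    have "norm z \<le> norm y + dist y z"
      by (metis add.commute dist_commute dist_norm norm_triangle_sub)
    then show ?thesis using B[OF y(1)] y(2) by linarith
  qed
  then show ?thesis by (auto simp: bounded_iff)
qed

lemma nbhd_lmeasurable:
  fixes X :: "'a::euclidean_space set"
  shows "bounded X \<Longrightarrow> nbhd X r \<in> lmeasurable"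
  by (intro lmeasurable_open nbhd_bounded nbhd_open)

lemma nbhd_ball_subset: "x \<in> X \<Longrightarrow> ball x r \<subseteq> nbhd X r"
  by (auto simp: nbhd_def)

lemma shadow_area_eq_size:
  fixes X :: "'a::euclidean_space set"
  assumes "bounded X"
  shows "shadow_area X = ennreal (shadow_size X)"
proof -
  have U: "nbhd X 1 \<in> lmeasurable" using assms by (rule nbhd_lmeasurable)
  have "ennreal 1 * shadow_area X \<le> of_nat DIM('a) * emeasure lebesgue (nbhd X 1)"
    by (rule shadow_area_thickened) (use U nbhd_ball_subset in auto)
  also have "\<dots> < \<infinity>" using U by (simp add: emeasure_eq_measure2 ennreal_mult_less_top of_nat_less_top)
  finally show ?thesis by (simp add: shadow_size_def)
qed

lemma shadow_size_nonneg [simp]: "0 \<le> shadow_size X"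
  by (simp add: shadow_size_def)

lemma shadow_size_thickened:
  fixes X U :: "'a::euclidean_space set"
  assumes "bounded X" "U \<in> lmeasurable" "0 < r" "\<And>x. x \<in> X \<Longrightarrow> ball x r \<subseteq> U"
  shows "r * shadow_size X \<le> real DIM('a) * measure lebesgue U"
proof -
  have "ennreal r * shadow_area X \<le> of_nat DIM('a) * emeasure lebesgue U"
    by (rule shadow_area_thickened) (use assms in auto)
  then have "ennreal (r * shadow_size X) \<le> ennreal (real DIM('a) * measure lebesgue U)"
    using assms by (simp add: shadow_area_eq_size emeasure_eq_measure2 ennreal_mult ennreal_of_nat_eq_real_of_nat)
  then show ?thesis by (subst (asm) ennreal_le_iff) auto
qed

lemma shadow_size_annulus:
  fixes A E G :: "'a::euclidean_space set"
  assumes "bounded E" "A \<subseteq> E" "0 < r" "G \<in> lmeasurable" "finite J" "\<And>j. j \<in> J \<Longrightarrow> bounded (S j)"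
    and "annulus E r \<subseteq> G \<union> (\<Union>j\<in>J. S j)"
  shows "r * shadow_size A \<le> r * (\<Sum>j\<in>J. shadow_size (S j)) + real DIM('a) * measure lebesgue G"
proof -
  have "bounded A" using assms bounded_subset by blast
  have "ennreal r * shadow_area A \<le> ennreal r * (\<Sum>j\<in>J. shadow_area (S j))
    + of_nat DIM('a) * emeasure lebesgue G"
    by (rule shadow_area_annulus) (use assms in \<open>auto simp: annulus_def nbhd_def\<close>)
  also have "(\<Sum>j\<in>J. shadow_area (S j)) = ennreal (\<Sum>j\<in>J. shadow_size (S j))"
    using assms by (simp add: shadow_area_eq_size)
  finally have "ennreal (r * shadow_size A)
    \<le> ennreal (r * (\<Sum>j\<in>J. shadow_size (S j)) + real DIM('a) * measure lebesgue G)"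
    using assms \<open>bounded A\<close>
    by (simp add: shadow_area_eq_size emeasure_eq_measure2 ennreal_mult ennreal_of_nat_eq_real_of_nat sum_nonneg)
  then show ?thesis using assms by (subst (asm) ennreal_le_iff) (auto intro!: add_nonneg_nonneg mult_nonneg_nonneg sum_nonneg)
qed

lemma root_power_le_shadow_size:
  fixes X :: "'a::euclidean_space set"
  assumes "bounded X" "X \<in> sets lebesgue" "0 < measure lebesgue X" "DIM('a) = Suc k"
  shows "root (Suc k) (measure lebesgue X) ^ k \<le> shadow_size X"
proof -
  let ?v = "root (Suc k) (measure lebesgue X)"
  have v: "0 < ?v" using assms by simp
  have "X \<in> lmeasurable" using assms by (simp add: bounded_set_imp_lmeasurable)
  then have "measure lebesgue X \<le> shadow_size X * ?v"
    using loomis_whitney[of X "shadow_size X"] assms by (simp add: shadow_area_eq_size)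
  moreover have "measure lebesgue X = ?v ^ k * ?v"
    using assms real_root_pow_pos2[of "Suc k" "measure lebesgue X"] by (simp add: mult.commute)
  ultimately show ?thesis using v by (metis mult_le_cancel_right_pos)
qed

lemma sum_measure_le_overlap:
  fixes A :: "'i \<Rightarrow> 'a set"
  assumes fin: "finite P" and A: "\<And>p. p \<in> P \<Longrightarrow> A p \<in> fmeasurable M" and G: "G \<in> fmeasurable M"
    and overlap: "\<And>x. (\<Sum>p\<in>P. indicat_real (A p) x) \<le> c * indicat_real G x"
  shows "(\<Sum>p\<in>P. measure M (A p)) \<le> c * measure M G"
proof -
  have int: "integrable M (indicat_real (A p))" if "p \<in> P" for p
    using A[OF that] by (auto simp: fmeasurable_def)
  have intG: "integrable M (indicat_real G)" using G by (auto simp: fmeasurable_def)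
  have "(\<Sum>p\<in>P. measure M (A p)) = (\<Sum>p\<in>P. integral\<^sup>L M (indicat_real (A p)))"
    using A by (intro sum.cong) (auto simp: fmeasurable_def dest: sets.sets_into_space intro!: arg_cong[where f="measure M"])
  also have "\<dots> = (\<integral>x. (\<Sum>p\<in>P. indicat_real (A p) x) \<partial>M)"
    using int by (simp add: Bochner_Integration.integral_sum)
  also have "\<dots> \<le> (\<integral>x. c * indicat_real G x \<partial>M)"
    using int intG overlap by (intro integral_mono) auto
  also have "\<dots> = c * measure M G"
    using G by (simp add: fmeasurable_def)
  finally show ?thesis .
qed

lemma finite_words: "finite (words n)"
  using finite_lists_length_eq[of "UNIV :: bool set" n] by simp

lemma card_words: "card (words n) = 2 ^ n"
  using card_lists_length_eq[of "UNIV :: bool set" n] by simp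

lemma card_continuations:
  assumes "length I \<le> m"
  shows "card {J \<in> words m. prefix I J} = 2 ^ (m - length I)"
proof -
  have "{J \<in> words m. prefix I J} = (\<lambda>K. I @ K) ` words (m - length I)"
    using assms by (auto simp: prefix_def)
  moreover have "inj_on (\<lambda>K. I @ K) (words (m - length I))" by (auto simp: inj_on_def)
  ultimately show ?thesis by (simp add: card_image card_words)
qed

lemma parallel_if_same_length: "length I = length J \<Longrightarrow> I \<noteq> J \<Longrightarrow> I \<parallel> J"
  by (rule parallelI) (auto simp: prefix_def)

lemma prefix_or_parallel:
  assumes "length I \<le> length J" shows "prefix I J \<or> I \<parallel> J"
proof (cases "prefix I J")
  case False
  then have "\<not> prefix J I" using assms by (auto simp: prefix_def)
  then show ?thesis using False parallelI by blast
qed simp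

context admissible_system
begin

text \<open>
  The points of \<open>S I\<close> lost by level \<open>m\<close>; their measure is what has to be bounded from below.
\<close>

definition gap :: "bool list \<Rightarrow> nat \<Rightarrow> (real ^ 'd) set" where
  "gap I m = S I - (\<Union>J\<in>words m. S J)"

lemma S_lmeasurable: "I \<noteq> [] \<Longrightarrow> S I \<in> lmeasurable"
  using S_measurable by (simp add: bounded_set_imp_lmeasurable)

lemma word_not_Nil: "1 \<le> n \<Longrightarrow> I \<in> words n \<Longrightarrow> I \<noteq> []"
  by auto

lemma gap_lmeasurable:
  assumes "I \<noteq> []" "1 \<le> m" shows "gap I m \<in> lmeasurable"
proof -
  have "(\<Union>J\<in>words m. S J) \<in> sets lebesgue"
  proof (rule sets.finite_UN[OF finite_words])
    show "S J \<in> sets lebesgue" if "J \<in> words m" for J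
      using S_measurable[OF word_not_Nil[OF assms(2) that]] by simp
  qed
  then show ?thesis
    unfolding gap_def using S_lmeasurable[OF assms(1)] by (intro fmeasurable_Diff) auto
qed

lemma gap_mono:
  assumes "1 \<le> m" "m \<le> m'" shows "gap I m \<subseteq> gap I m'"
proof -
  have "\<exists>J\<in>words m. S J' \<subseteq> S J" if J': "J' \<in> words m'" for J'
  proof
    show "take m J' \<in> words m" using J' assms by simp
    show "S J' \<subseteq> S (take m J')"
      using J' assms by (intro S_mono) (auto simp: take_is_prefix)
  qed
  then show ?thesis unfolding gap_def by blast
qed

lemma measure_gap:
  assumes I: "I \<noteq> []" and m: "length I \<le> m"
  shows "measure lebesgue (gap I m)
    = measure lebesgue (S I) - (\<Sum>J\<in>{J \<in> words m. prefix I J}. measure lebesgue (S J))"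
proof -
  let ?C = "{J \<in> words m. prefix I J}"
  have m1: "1 \<le> m" using I m by (cases I) auto
  have sub: "S J \<subseteq> S I" if "J \<in> ?C" for J using that I m1 by (intro S_mono) auto
  have eq: "gap I m = S I - (\<Union>J\<in>?C. S J)"
  proof -
    have "S I \<inter> S J = {}" if "J \<in> words m" "\<not> prefix I J" for J
      using S_disjoint prefix_or_parallel[of I J] that m by blast
    then show ?thesis unfolding gap_def by blast
  qed
  have fin: "finite ?C" using finite_words[of m] by simp
  have meas: "S J \<in> lmeasurable" if "J \<in> ?C" for J using that m1 by (intro S_lmeasurable) auto
  have disj: "disjoint_family_on S ?C"
    unfolding disjoint_family_on_def using S_disjoint parallel_if_same_length by fastforce
  have "(\<Union>J\<in>?C. S J) \<in> lmeasurable" using fin meas by (intro fmeasurable.finite_UN) auto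
  then have "measure lebesgue (gap I m) = measure lebesgue (S I) - measure lebesgue (\<Union>J\<in>?C. S J)"
    unfolding eq using sub S_lmeasurable[OF I] by (intro measurable_measure_Diff) auto
  also have "measure lebesgue (\<Union>J\<in>?C. S J) = (\<Sum>J\<in>?C. measure lebesgue (S J))"
    by (rule measure_finite_Union) (use fin fmeasurableD[OF meas] fmeasurableD2[OF meas] disj in auto)
  finally show ?thesis .
qed

text \<open>
  Each annulus around \<open>E m I' j\<close> shields \<open>S I'\<close>: the shadow of \<open>S I'\<close> is covered by the shadows of
  the level-\<open>m\<close> sets meeting the annulus, up to lines that run for a length \<open>r m\<close> in the gap. Sum
  over all \<open>I'\<close> in \<open>W I n\<close> and all of the at least \<open>k n m\<close> indices \<open>j\<close>. Every level-\<open>m\<close> set is used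
  at most \<open>C\<close> times, and belongs to \<open>W I m\<close>; a point of the gap is used at most
  \<open>c0 * k n m * r m / r n\<close> times. Division by \<open>r m * k n m\<close> gives the estimate.
\<close>

lemma shadow_recursion:
  assumes I: "I \<noteq> []" "length I + q \<le> n" "n + q \<le> m" and q: "1 \<le> q"
    and r: "0 < r n" "0 < r m" and k: "0 < k n m"
  shows "(\<Sum>I'\<in>W I n. shadow_size (S I')) \<le> real C / k n m * (\<Sum>J\<in>W I m. shadow_size (S J))
    + real CARD('d) * c0 * measure lebesgue (gap I m) / r n"
proof -
  have n: "1 \<le> n" "n < m" using I q by (auto simp: Suc_le_eq)
  have Wn: "W I n \<subseteq> words n" and Wm: "W I m \<subseteq> words m"
    using W_subwords[of I n] W_subwords[of I m] I by auto
  have finW: "finite (W I n)" "finite (W I m)"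
    using finite_subset[OF Wn finite_words] finite_subset[OF Wm finite_words] by auto
  let ?N = "{j. real j < k n m}"
  have N: "?N = {..<nat \<lceil>k n m\<rceil>}"
    by (auto simp: less_ceiling_iff zless_nat_eq_int_zless)
  have finN: "finite ?N" and cardN: "k n m \<le> real (card ?N)"
    unfolding N using k by (auto simp: of_nat_nat)
  define P where "P = W I n \<times> ?N"
  have finP: "finite P" using finW finN by (simp add: P_def)
  define D where "D = (\<lambda>(I', j). annulus (E m I' j) (r m))"
  have Dsub: "D p \<subseteq> S I" if "p \<in> P" for p
    using annuli_inside[OF I] that by (auto simp: P_def D_def)
  have Dmeas: "D p \<in> sets lebesgue" if "p \<in> P" for p
  proof -
    have "bounded (E m (fst p) (snd p)) \<and> E m (fst p) (snd p) \<in> sets lebesgue"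
      using E_measurable[of n m "fst p" "snd p"] that n Wn by (auto simp: P_def)
    then have "nbhd (E m (fst p) (snd p)) (r m) - E m (fst p) (snd p) \<in> sets lebesgue"
      using nbhd_lmeasurable by (intro sets.Diff) (auto intro: fmeasurableD)
    then show ?thesis by (simp add: D_def annulus_def case_prod_unfold)
  qed
  define meet where "meet p = {J \<in> W I m. D p \<inter> S J \<noteq> {}}" for p
  have single: "r m * shadow_size (S (fst p)) \<le> r m * (\<Sum>J\<in>meet p. shadow_size (S J))
      + real CARD('d) * measure lebesgue (gap I m \<inter> D p)" if p: "p \<in> P" for p
  proof -
    obtain I' j where p': "p = (I', j)" by (cases p)
    have I': "I' \<in> W I n" "real j < k n m" using p p' by (auto simp: P_def)
    have I'w: "I' \<in> words n" using I' Wn by auto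
    have "r m * shadow_size (S I') \<le> r m * (\<Sum>J\<in>meet p. shadow_size (S J))
      + real DIM(real ^ 'd) * measure lebesgue (gap I m \<inter> D p)"
    proof (rule shadow_size_annulus)
      show "bounded (E m I' j)" using E_measurable[of n m I' j] n I'w by simp
      show "S I' \<subseteq> E m I' j" using S_subset_E[of n m I' j] n I'w by simp
      show "gap I m \<inter> D p \<in> lmeasurable"
        using gap_lmeasurable[of I m] Dmeas[OF p] n I by (intro fmeasurable_Int_fmeasurable) auto
      show "finite (meet p)" using finW by (simp add: meet_def)
      show "bounded (S J)" if "J \<in> meet p" for J
      proof -
        have "J \<in> words m" using that Wm by (auto simp: meet_def)
        then show ?thesis using S_measurable[OF word_not_Nil[of m]] n by simp
      qed
      show "annulus (E m I' j) (r m) \<subseteq> gap I m \<inter> D p \<union> (\<Union>J\<in>meet p. S J)"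
      proof
        fix x assume x: "x \<in> annulus (E m I' j) (r m)"
        then have xD: "x \<in> D p" by (simp add: D_def p')
        then have xS: "x \<in> S I" using Dsub[OF p] by blast
        show "x \<in> gap I m \<inter> D p \<union> (\<Union>J\<in>meet p. S J)"
        proof (cases "\<exists>J\<in>words m. x \<in> S J")
          case True
          then obtain J where J: "J \<in> words m" "x \<in> S J" by blast
          then have "J \<in> W I m" using W_closed[OF I I' J(1)] x by blast
          then show ?thesis using J xD by (auto simp: meet_def)
        next
          case False
          then show ?thesis using xD xS by (auto simp: gap_def)
        qed
      qed
    qed (use r in simp)
    then show ?thesis by (simp add: p')
  qed
  let ?Pn = "\<Sum>I'\<in>W I n. shadow_size (S I')" and ?Pm = "\<Sum>J\<in>W I m. shadow_size (S J)"
  have "r m * (k n m * ?Pn) \<le> r m * (real (card ?N) * ?Pn)"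
    using r cardN by (intro mult_left_mono mult_right_mono sum_nonneg) auto
  also have "\<dots> = (\<Sum>p\<in>P. r m * shadow_size (S (fst p)))"
  proof -
    have "(\<Sum>p\<in>P. r m * shadow_size (S (fst p))) = (\<Sum>I'\<in>W I n. \<Sum>j\<in>?N. r m * shadow_size (S I'))"
      unfolding P_def sum.cartesian_product by (simp add: case_prod_unfold)
    then show ?thesis by (simp add: sum_distrib_left sum_distrib_right mult_ac)
  qed
  also have "\<dots> \<le> (\<Sum>p\<in>P. r m * (\<Sum>J\<in>meet p. shadow_size (S J))
      + real CARD('d) * measure lebesgue (gap I m \<inter> D p))"
    by (rule sum_mono) (rule single)
  also have "\<dots> = r m * (\<Sum>p\<in>P. \<Sum>J\<in>meet p. shadow_size (S J))
      + real CARD('d) * (\<Sum>p\<in>P. measure lebesgue (gap I m \<inter> D p))"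
    by (simp add: sum.distrib sum_distrib_left)
  also have "(\<Sum>p\<in>P. \<Sum>J\<in>meet p. shadow_size (S J)) \<le> real C * ?Pm"
  proof -
    have "(\<Sum>p\<in>P. \<Sum>J\<in>meet p. shadow_size (S J))
      = (\<Sum>J\<in>W I m. \<Sum>p\<in>{p \<in> P. D p \<inter> S J \<noteq> {}}. shadow_size (S J))"
      unfolding meet_def by (rule sum.swap_restrict) (use finP finW in auto)
    also have "\<dots> = (\<Sum>J\<in>W I m. real (card {p \<in> P. D p \<inter> S J \<noteq> {}}) * shadow_size (S J))"
      by simp
    also have "\<dots> \<le> (\<Sum>J\<in>W I m. real C * shadow_size (S J))"
    proof (intro sum_mono mult_right_mono)
      fix J assume J: "J \<in> W I m"
      let ?X = "{(I, j). I \<in> words n \<and> real j < k n m \<and> annulus (E m I j) (r m) \<inter> S J \<noteq> {}}"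
      have "?X \<subseteq> words n \<times> ?N" by auto
      then have "finite ?X" using finite_subset finite_cartesian_product[OF finite_words finN] by blast
      moreover have "{p \<in> P. D p \<inter> S J \<noteq> {}} \<subseteq> ?X" using Wn by (auto simp: P_def D_def)
      ultimately have "card {p \<in> P. D p \<inter> S J \<noteq> {}} \<le> card ?X" by (rule card_mono)
      also have "\<dots> \<le> C" using few_annuli_meet[of n m J] n J Wm by auto
      finally show "real (card {p \<in> P. D p \<inter> S J \<noteq> {}}) \<le> real C" by simp
    qed auto
    finally show ?thesis by (simp add: sum_distrib_left)
  qed
  also have "(\<Sum>p\<in>P. measure lebesgue (gap I m \<inter> D p)) \<le> c0 * k n m * r m / r n * measure lebesgue (gap I m)"
  proof (rule sum_measure_le_overlap[OF finP])
    show "gap I m \<in> lmeasurable" using gap_lmeasurable I n by simp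
    then show "gap I m \<inter> D p \<in> lmeasurable" if "p \<in> P" for p
      using Dmeas[OF that] by (intro fmeasurable_Int_fmeasurable)
    fix x
    let ?X = "{(I, j). I \<in> words n \<and> real j < k n m}"
    have "?X = words n \<times> ?N" by auto
    then have finX: "finite ?X" using finite_words finN by simp
    have "(\<Sum>p\<in>P. indicat_real (gap I m \<inter> D p) x) = (\<Sum>p\<in>P. indicat_real (D p) x) * indicat_real (gap I m) x"
      unfolding sum_distrib_right by (rule sum.cong) (auto simp: indicator_def)
    also have "(\<Sum>p\<in>P. indicat_real (D p) x) \<le> (\<Sum>p\<in>?X. indicat_real (D p) x)"
      using Wn by (intro sum_mono2 finX) (auto simp: P_def)
    also have "(\<Sum>p\<in>?X. indicat_real (D p) x) \<le> c0 * k n m * r m / r n"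
      using annuli_overlap[OF n, of x] by (simp add: D_def case_prod_unfold)
    finally show "(\<Sum>p\<in>P. indicat_real (gap I m \<inter> D p) x) \<le> c0 * k n m * r m / r n * indicat_real (gap I m) x"
      by (simp add: mult_right_mono)
  qed
  finally have "r m * k n m * ?Pn \<le> r m * (real C * ?Pm)
      + real CARD('d) * (c0 * k n m * r m / r n * measure lebesgue (gap I m))"
    using r by (simp add: mult_left_mono algebra_simps)
  also have "\<dots> = r m * k n m * (real C / k n m * ?Pm
      + real CARD('d) * c0 * measure lebesgue (gap I m) / r n)"
    using r k by (simp add: field_simps)
  finally have "r m * k n m * ?Pn \<le> r m * k n m * (real C / k n m * ?Pm
      + real CARD('d) * c0 * measure lebesgue (gap I m) / r n)" .
  then show ?thesis using r k by (simp add: mult_le_cancel_left_pos)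
qed

text \<open>
  The shadow of a set is bounded by a multiple of the measure of its \<open>r m\<close>-neighbourhood, divided
  by \<open>r m\<close>, and at a given level these neighbourhoods have bounded overlap inside a fixed bounded set.
\<close>

lemma total_shadow_bounded:
  assumes r: "\<And>n. 1 \<le> n \<Longrightarrow> 0 < r n" "\<And>n. 1 \<le> n \<Longrightarrow> r n \<le> r 1"
  shows "\<exists>K. \<forall>m\<ge>1. r m * (\<Sum>J\<in>words m. shadow_size (S J)) \<le> K"
proof -
  define V where "V = nbhd (\<Union>J\<in>words 1. S J) (r 1)"
  have V: "V \<in> lmeasurable" unfolding V_def
  proof (rule nbhd_lmeasurable, rule bounded_UN[OF finite_words], rule ballI)
    show "bounded (S J)" if "J \<in> words 1" for J using S_measurable[OF word_not_Nil[OF order.refl that]] by simp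
  qed
  have "r m * (\<Sum>J\<in>words m. shadow_size (S J)) \<le> real CARD('d) * ((c0 + 1) * measure lebesgue V)" if m: "1 \<le> m" for m
  proof -
    let ?B = "\<lambda>J. nbhd (S J) (r m)"
    have bdd: "bounded (S J)" if "J \<in> words m" for J
      using S_measurable[OF word_not_Nil[OF m that]] by simp
    have "r m * (\<Sum>J\<in>words m. shadow_size (S J)) = (\<Sum>J\<in>words m. r m * shadow_size (S J))"
      by (rule sum_distrib_left)
    also have "\<dots> \<le> (\<Sum>J\<in>words m. real DIM(real ^ 'd) * measure lebesgue (?B J))"
    proof (intro sum_mono shadow_size_thickened)
      fix J assume J: "J \<in> words m"
      show "bounded (S J)" using bdd[OF J] .
      then show "?B J \<in> lmeasurable" by (rule nbhd_lmeasurable)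
      show "0 < r m" using r(1)[OF m] .
      show "ball x (r m) \<subseteq> ?B J" if "x \<in> S J" for x using that by (rule nbhd_ball_subset)
    qed
    also have "\<dots> = real CARD('d) * (\<Sum>J\<in>words m. measure lebesgue (?B J))"
      by (simp add: sum_distrib_left)
    also have "(\<Sum>J\<in>words m. measure lebesgue (?B J)) \<le> (c0 + 1) * measure lebesgue V"
    proof (rule sum_measure_le_overlap[OF finite_words])
      show "V \<in> lmeasurable" by (rule V)
      show "?B J \<in> lmeasurable" if "J \<in> words m" for J using bdd[OF that] by (rule nbhd_lmeasurable)
      fix x
      let ?Y = "{J \<in> words m. x \<in> ?B J}"
      have sum: "(\<Sum>J\<in>words m. indicat_real (?B J) x) = real (card ?Y)"
        using finite_words by (simp add: indicator_def sum.If_cases Int_def)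
      show "(\<Sum>J\<in>words m. indicat_real (?B J) x) \<le> (c0 + 1) * indicat_real V x"
      proof (cases "?Y = {}")
        case True
        then show ?thesis using sum c0_ge_1 by simp
      next
        case False
        then obtain I where I: "I \<in> words m" "x \<in> ?B I" by blast
        let ?Z = "{I' \<in> words m. I' \<parallel> I \<and> ?B I \<inter> ?B I' \<noteq> {}}"
        have "?Y \<subseteq> insert I ?Z"
          using I parallel_if_same_length by fastforce
        then have "card ?Y \<le> card (insert I ?Z)"
          using finite_words by (intro card_mono) auto
        also have "\<dots> \<le> Suc (card ?Z)" by (rule card_insert_le_m1) auto
        finally have "real (card ?Y) \<le> c0 + 1"
          using few_neighbours[OF m order.refl I(1)] by linarith
        moreover have "x \<in> V"
        proof -
          obtain y where y: "y \<in> S I" "dist y x < r m" using I(2) by (auto simp: nbhd_def)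
          have "S I \<subseteq> S (take 1 I)"
            using I(1) m by (intro S_mono) (auto simp: take_is_prefix)
          moreover have "take 1 I \<in> words 1" using I(1) m by simp
          ultimately have "y \<in> (\<Union>J\<in>words 1. S J)" using y(1) by blast
          moreover have "x \<in> ball y (r 1)" using y(2) r(2)[OF m] by simp
          ultimately show ?thesis unfolding V_def nbhd_def by (rule UN_I)
        qed
        ultimately show ?thesis using sum by simp
      qed
    qed
    finally show ?thesis by (simp add: mult_left_mono)
  qed
  then show ?thesis by blast
qed

end

section \<open>Summability from an admissible system\<close>

context admissible_system
begin

text \<open>
  The argument is run at each level for a set of least measure: the loss inside such a set
  is a lower bound for the decrease of the rescaled least measure.
\<close>

definition least_measure :: "nat \<Rightarrow> real" where
  "least_measure n = Min ((\<lambda>I. measure lebesgue (S I)) ` words n)"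

text \<open>
  The side length of a cube with measure \<open>least_measure n\<close>, in units of the side length
  \<open>2 powr (- n / d)\<close> of a cube with measure \<open>1 / 2 ^ n\<close>.
\<close>

definition scaled_root :: "nat \<Rightarrow> real" where
  "scaled_root n = root CARD('d) (2 ^ n * least_measure n)"

lemma words_not_empty: "words n \<noteq> {}"
  by (metis (mono_tags) Collect_empty_eq length_replicate)

lemma least_measure_le: "I \<in> words n \<Longrightarrow> least_measure n \<le> measure lebesgue (S I)"
  unfolding least_measure_def using finite_words by (intro Min_le) auto

lemma least_measure_attained: "\<exists>I\<in>words n. measure lebesgue (S I) = least_measure n"
proof -
  have "least_measure n \<in> (\<lambda>I. measure lebesgue (S I)) ` words n"
    unfolding least_measure_def using finite_words words_not_empty by (intro Min_in) auto
  then show ?thesis by auto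
qed

lemma least_measure_nonneg: "0 \<le> least_measure n"
  using least_measure_attained[of n] measure_nonneg by metis

lemma scaled_root_nonneg: "0 \<le> scaled_root n"
  using least_measure_nonneg by (simp add: scaled_root_def)

lemma scaled_root_power: "scaled_root n ^ CARD('d) = 2 ^ n * least_measure n"
  using least_measure_nonneg by (simp add: scaled_root_def)

text \<open>
  \<open>S I\<close> contains \<open>2 ^ (e - l)\<close> disjoint sets of level \<open>e\<close>, all of at least the least measure.
\<close>

lemma gap_le_decrease:
  assumes I: "I \<in> words l" "measure lebesgue (S I) = least_measure l" and l: "1 \<le> l" "l \<le> e"
  shows "2 ^ l * measure lebesgue (gap I e) \<le> scaled_root l ^ CARD('d) - scaled_root e ^ CARD('d)"
proof -
  let ?C = "{J \<in> words e. prefix I J}"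
  have "I \<noteq> []" using I l by auto
  have "card ?C = 2 ^ (e - l)" using card_continuations[of I e] I l by simp
  then have "2 ^ (e - l) * least_measure e = (\<Sum>J\<in>?C. least_measure e)"
    by simp
  also have "\<dots> \<le> (\<Sum>J\<in>?C. measure lebesgue (S J))"
    by (rule sum_mono) (rule least_measure_le, simp)
  finally have "measure lebesgue (gap I e) \<le> least_measure l - 2 ^ (e - l) * least_measure e"
    using measure_gap[OF \<open>I \<noteq> []\<close>, of e] I l by simp
  then have "2 ^ l * measure lebesgue (gap I e) \<le> 2 ^ l * (least_measure l - 2 ^ (e - l) * least_measure e)"
    by simp
  also have "\<dots> = 2 ^ l * least_measure l - 2 ^ (l + (e - l)) * least_measure e"
    by (simp add: power_add algebra_simps)
  finally show ?thesis using l by (simp add: scaled_root_power)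
qed

lemma scaled_root_antimono:
  assumes "1 \<le> l" "l \<le> e" shows "scaled_root e \<le> scaled_root l"
proof -
  obtain I where "I \<in> words l" "measure lebesgue (S I) = least_measure l"
    using least_measure_attained by blast
  then have "2 ^ l * measure lebesgue (gap I e) \<le> scaled_root l ^ CARD('d) - scaled_root e ^ CARD('d)"
    using assms by (rule gap_le_decrease)
  moreover have "0 \<le> 2 ^ l * measure lebesgue (gap I e)" by simp
  ultimately have "scaled_root e ^ CARD('d) \<le> scaled_root l ^ CARD('d)" by linarith
  then show ?thesis using scaled_root_nonneg by (simp add: power_mono_iff)
qed

lemma radius_le_scaled_root:
  "\<exists>K>0. \<forall>n\<ge>1. 0 < r n \<longrightarrow> 2 powr (real n / real CARD('d)) * r n \<le> K * scaled_root n"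
proof -
  let ?d = "CARD('d)"
  define v where "v = unit_ball_vol (real ?d)"
  have v: "0 < v" by (simp add: v_def)
  have rv: "0 < root ?d v" using v by simp
  have "2 powr (real n / real ?d) * r n \<le> c0 / root ?d v * scaled_root n" if n: "1 \<le> n" and rn: "0 < r n" for n
  proof -
    obtain I where I: "I \<in> words n" "measure lebesgue (S I) = least_measure n"
      using least_measure_attained by blast
    obtain x s where s: "r n / c0 \<le> s" "ball x s \<subseteq> S I"
      using S_contains_ball[OF n I(1)] by blast
    have rc: "0 < r n / c0" using rn c0_ge_1 by simp
    have "v * (r n / c0) ^ ?d \<le> v * s ^ ?d"
      using s rc v by (intro mult_left_mono power_mono) auto
    also have "\<dots> = measure lebesgue (ball x s)"
      using s rc content_ball[of s x] by (simp add: v_def)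
    also have "\<dots> \<le> measure lebesgue (S I)"
      using s S_lmeasurable[OF word_not_Nil[OF n I(1)]] by (intro measure_mono_fmeasurable) auto
    finally have "v * (r n / c0) ^ ?d \<le> least_measure n" using I by simp
    then have "2 ^ n * (v * (r n / c0) ^ ?d) \<le> 2 ^ n * least_measure n" by simp
    then have "root ?d (2 ^ n * (v * (r n / c0) ^ ?d)) \<le> scaled_root n"
      unfolding scaled_root_def by (intro real_root_le_mono) auto
    also have "root ?d (2 ^ n * (v * (r n / c0) ^ ?d)) = root ?d (2 ^ n) * (root ?d v * (r n / c0))"
      using rc by (simp add: real_root_mult real_root_power_cancel del: times_divide_eq_right)
    also have "root ?d (2 ^ n) = 2 powr (real n / real ?d)"
      by (simp add: root_powr_inverse powr_powr flip: powr_realpow)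
    finally have "c0 / root ?d v * (2 powr (real n / real ?d) * (root ?d v * (r n / c0))) \<le> c0 / root ?d v * scaled_root n"
      using rv c0_ge_1 by (intro mult_left_mono) auto
    then show ?thesis using rv c0_ge_1 by simp
  qed
  moreover have "0 < c0 / root ?d v" using rv c0_ge_1 by simp
  ultimately show ?thesis by blast
qed

text \<open>
  Let \<open>a n = 2 powr (n / d) * r n\<close> and \<open>y n = scaled_root n\<close>. It suffices to find for each \<open>l\<close> some
  \<open>e > l\<close> such that the sum of \<open>a\<close> over \<open>[l + q, e + q)\<close> is at most a constant times \<open>y l - y e\<close>.
  If \<open>y (l + q)\<close> is less than half of \<open>y l\<close>, then \<open>e = l + q\<close> will do, because
  \<open>a n\<close> is bounded by a multiple of \<open>y n\<close>. Otherwise take \<open>I\<close> with \<open>S I\<close> of least measure and apply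
  the lemma on chains of scales to the rescaled shadows \<open>T n\<close> of the sets in
  \<open>W I n\<close>: the recursion for the shadows becomes the step inequality with weights \<open>C * 2 powr ((m - n) / d) / k n m\<close>, and the lower bound for
  \<open>T (l + q)\<close> comes from the Loomis--Whitney inequality. The resulting bound by the measure of a gap
  is one by \<open>y l ^ d - y e ^ d\<close>, and hence by \<open>y l - y e\<close>.
\<close>

lemma summable_radii:
  assumes q: "1 \<le> q" and C: "1 \<le> C"
    and r_pos: "\<And>n. 1 \<le> n \<Longrightarrow> 0 < r n" and r_mono: "\<And>n m. 1 \<le> n \<Longrightarrow> n \<le> m \<Longrightarrow> r m \<le> r n"
    and k_pos: "\<And>n m. 1 \<le> n \<Longrightarrow> n \<le> m \<Longrightarrow> 0 < k n m"
    and k_sum: "\<And>n N. 1 \<le> n \<Longrightarrow> (\<Sum>i<N. 2 powr (real i / real CARD('d)) / k n (n + i)) \<le> H"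
    and k_large: "\<And>n m. 1 \<le> n \<Longrightarrow> n + N \<le> m \<Longrightarrow>
      2 powr (real (m - n) / real CARD('d)) / k n m < 1 / (4 * real C)"
  shows "summable (\<lambda>n. 2 powr (real n / real CARD('d)) * r n)"
proof (rule ccontr)
  let ?d = "CARD('d)"
  define a where "a n = 2 powr (real n / real ?d) * r n" for n
  assume "\<not> ?thesis"
  then have nosum: "\<not> summable a" unfolding a_def .
  have a_pos: "0 < a n" if "1 \<le> n" for n using r_pos[OF that] by (simp add: a_def)
  have a_dbl: "a (Suc n) \<le> 2 * a n" if "1 \<le> n" for n
  proof -
    have "real (Suc n) / real ?d = real n / real ?d + 1 / real ?d" by (simp add: add_divide_distrib)
    then have "2 powr (real (Suc n) / real ?d) = 2 powr (real n / real ?d) * 2 powr (1 / real ?d)"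
      by (simp only: powr_add)
    also have "\<dots> \<le> 2 powr (real n / real ?d) * 2 powr 1"
      by (intro mult_left_mono powr_mono) (auto simp: Suc_leI)
    finally have "a (Suc n) \<le> 2 * 2 powr (real n / real ?d) * r (Suc n)"
      using r_pos[of "Suc n"] by (simp add: a_def mult_right_mono)
    also have "\<dots> \<le> 2 * 2 powr (real n / real ?d) * r n"
      using r_mono[of n "Suc n"] that by (intro mult_left_mono) auto
    finally show ?thesis by (simp add: a_def mult.assoc)
  qed
  have unbounded: "\<exists>M. B \<le> (\<Sum>n\<in>{n0..<M}. a n)" if n0: "1 \<le> n0" for n0 B
  proof (rule ccontr)
    assume "\<not> ?thesis"
    then have *: "(\<Sum>n\<in>{n0..<M}. a n) \<le> B" for M by (meson linear)
    have "(\<Sum>i<j. a (i + n0)) \<le> B" for j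
    proof -
      have "(\<Sum>i<j. a (i + n0)) = (\<Sum>n\<in>{0 + n0..<j + n0}. a n)"
        by (subst sum.shift_bounds_nat_ivl) (simp add: lessThan_atLeast0)
      then show ?thesis using *[of "j + n0"] by simp
    qed
    then have "summable (\<lambda>i. a (i + n0))"
      using a_pos n0 by (intro summableI_nonneg_bounded) (auto intro: less_imp_le)
    then show False using nosum summable_iff_shift by blast
  qed
  obtain Kb where Kb: "0 < Kb" "\<And>n. 1 \<le> n \<Longrightarrow> a n \<le> Kb * scaled_root n"
    using radius_le_scaled_root r_pos unfolding a_def by metis
  obtain K where K: "\<And>m. 1 \<le> m \<Longrightarrow> r m * (\<Sum>J\<in>words m. shadow_size (S J)) \<le> K"
    using total_shadow_bounded r_pos r_mono by (metis order.refl)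
  define w where "w n m = real C * (2 powr (real (m - n) / real ?d) / k n m)" for n m
  define H' where "H' = real C * (H + 1)"
  have H: "0 \<le> H" using k_sum[of 1 0] by simp
  have H': "0 < H'" using H C by (simp add: H'_def)
  have w_sum: "(\<Sum>m\<in>{n..<M}. w n m) \<le> H'" if n: "1 \<le> n" for n M
  proof -
    have "(\<Sum>m\<in>{n..<M}. w n m) = real C * (\<Sum>i<M - n. 2 powr (real i / real ?d) / k n (n + i))"
      unfolding sum.atLeastLessThan_shift_0[of _ n M] by (simp add: w_def sum_distrib_left lessThan_atLeast0)
    also have "\<dots> \<le> real C * (H + 1)" using k_sum[OF n, of "M - n"] by (intro mult_left_mono) auto
    finally show ?thesis by (simp add: H'_def)
  qed
  define s where "s = max N q"
  have w_small: "w n m \<le> 1 / 4" if "1 \<le> n" "n + s \<le> m" for n m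
  proof -
    have "w n m \<le> real C * (1 / (4 * real C))"
      unfolding w_def using that
      by (intro mult_left_mono less_imp_le[OF k_large]) (auto simp: s_def)
    then show ?thesis using C by simp
  qed
  obtain \<kappa> where \<kappa>: "?d = Suc \<kappa>" using zero_less_card_finite gr0_implies_Suc by blast
  define A0 where "A0 = 4 * (real (s + 1) * 2 ^ s + 12 * H') * (real ?d * c0)"
  have A0: "0 \<le> A0" using H' c0_ge_1 by (simp add: A0_def)
  define F where "F = 1 + 2 * real q * 2 ^ q"
  define A1 where "A1 = F * A0 * 2 ^ q * real ?d * 2 ^ \<kappa>"
  define A2 where "A2 = real q * 2 ^ q * Kb"
  have A12: "0 \<le> A1" "0 \<le> A2" using A0 Kb by (auto simp: A1_def A2_def F_def)
  have "\<exists>e>l. (\<Sum>n\<in>{l + q..<e + q}. a n) \<le> (A1 + A2) * (scaled_root l - scaled_root e)" if l: "1 \<le> l" for l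
  proof -
    define n0 where "n0 = l + q"
    have n0: "1 \<le> n0" "l < n0" using l q by (auto simp: n0_def)
    have weaken: "B * (scaled_root l - scaled_root e) \<le> (A1 + A2) * (scaled_root l - scaled_root e)"
      if "B \<le> A1 + A2" "l \<le> e" for B e
      using that scaled_root_antimono[OF l, of e] by (intro mult_right_mono) auto
    \<comment> \<open>either the scaled root is comparable at \<open>l\<close> and \<open>n0\<close>, or it has dropped to less than half\<close>
    show ?thesis
    proof (cases "scaled_root l / 2 \<le> scaled_root n0")
      case False
      have "(\<Sum>n\<in>{n0..<n0 + q}. a n) \<le> real q * 2 ^ q * a n0"
        using a_pos[of n0] a_dbl n0 by (intro doubling_sum_le[of 1]) auto
      also have "\<dots> \<le> real q * 2 ^ q * (Kb * scaled_root n0)"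
        using Kb n0 by (intro mult_left_mono) auto
      also have "\<dots> \<le> A2 * (scaled_root l - scaled_root n0)"
        unfolding A2_def mult.assoc using False Kb by (intro mult_left_mono) auto
      also have "\<dots> \<le> (A1 + A2) * (scaled_root l - scaled_root n0)"
        using A12 n0 by (intro weaken) auto
      finally show ?thesis using n0 by (intro exI[of _ n0]) (simp add: n0_def)
    next
      case True
      obtain I where I: "I \<in> words l" "measure lebesgue (S I) = least_measure l"
        using least_measure_attained by blast
      have Ine: "I \<noteq> []" using I l by auto
      define T where "T n = 2 powr (- real n / real ?d) * (\<Sum>I'\<in>W I n. shadow_size (S I'))" for n
      define g where "g m = measure lebesgue (gap I m)" for m
      have W: "W I n \<noteq> {}" "W I n \<subseteq> words n" if "n0 \<le> n" for n
        using W_subwords[of I n] Ine I that by (auto simp: n0_def)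
      have W_fin: "finite (W I n)" if "n0 \<le> n" for n
        using W(2)[OF that] finite_words finite_subset by blast
      have y_pos: "0 < scaled_root n" if "1 \<le> n" for n
        using Kb(2)[OF that] a_pos[OF that] Kb(1) scaled_root_nonneg[of n]
        by (metis less_le_trans mult_zero_right not_less order_le_less)
      have T_ge: "scaled_root n0 ^ \<kappa> / 2 ^ n0 \<le> T n0"
      proof -
        obtain I' where I': "I' \<in> W I n0" using W[of n0] by blast
        then have I'w: "I' \<in> words n0" using W[of n0] by blast
        let ?u = "2 powr (- real n0 / real ?d)"
        have "?u ^ Suc \<kappa> = 2 powr (real (Suc \<kappa>) * (- real n0 / real ?d))"
          by (simp add: powr_power mult.commute del: power_Suc of_nat_Suc)
        also have "real (Suc \<kappa>) * (- real n0 / real ?d) = - real n0"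
          unfolding \<kappa> by (simp del: of_nat_Suc)
        finally have u: "?u ^ Suc \<kappa> = 1 / 2 ^ n0"
          by (simp add: powr_minus_divide powr_realpow del: power_Suc)
        have lm: "0 < least_measure n0"
          using y_pos[OF n0(1)] scaled_root_power[of n0] by (metis zero_less_mult_pos zero_less_numeral zero_less_power)
        have "root ?d (2 ^ n0) = 2 powr (real n0 / real ?d)"
          by (simp add: root_powr_inverse powr_powr flip: powr_realpow)
        then have "?u * scaled_root n0 = ?u * 2 powr (real n0 / real ?d) * root ?d (least_measure n0)"
          by (simp add: scaled_root_def real_root_mult)
        also have "?u * 2 powr (real n0 / real ?d) = 1"
          by (simp flip: powr_add)
        finally have us: "?u * scaled_root n0 = root ?d (least_measure n0)" by simp
        have "root ?d (least_measure n0) ^ \<kappa> \<le> root ?d (measure lebesgue (S I')) ^ \<kappa>"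
          using least_measure_le[OF I'w] lm by (intro power_mono) auto
        also have "\<dots> \<le> shadow_size (S I')"
          unfolding \<kappa> using S_measurable[OF word_not_Nil[OF n0(1) I'w]] lm least_measure_le[OF I'w] \<kappa>
          by (intro root_power_le_shadow_size) auto
        also have "\<dots> \<le> (\<Sum>I'\<in>W I n0. shadow_size (S I'))"
          using W_fin I' by (intro member_le_sum) auto
        finally have "?u * (?u * scaled_root n0) ^ \<kappa> \<le> T n0"
          unfolding us T_def by (intro mult_left_mono) auto
        also have "?u * (?u * scaled_root n0) ^ \<kappa> = ?u ^ Suc \<kappa> * scaled_root n0 ^ \<kappa>"
          by (simp add: power_mult_distrib)
        finally show ?thesis unfolding u by simp
      qed
      have "\<exists>e>n0. T n0 * (\<Sum>n\<in>{n0..<e}. a n) \<le> 4 * (real (s + 1) * 2 ^ s + 12 * H') * (real ?d * c0) * g e"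
      proof (rule chain_block)
        show "0 < a n" if "n0 \<le> n" for n using a_pos n0 that by simp
        show "a (Suc n) \<le> 2 * a n" if "n0 \<le> n" for n using a_dbl n0 that by simp
        show "\<exists>M. B \<le> (\<Sum>n\<in>{n0..<M}. a n)" for B using unbounded n0 by simp
        show "0 \<le> w n m" if "n0 \<le> n" "n \<le> m" for n m
          using k_pos[of n m] n0 that by (simp add: w_def)
        show "w n m \<le> 1 / 4" if "n0 \<le> n" "n + s \<le> m" for n m using w_small n0 that by simp
        show "(\<Sum>m\<in>{n..<M}. w n m) \<le> H'" if "n0 \<le> n" for n M using w_sum n0 that by simp
        show "0 < H'" by (rule H')
        show "0 < T n0" using T_ge y_pos[OF n0(1)] by (smt (verit) divide_pos_pos zero_less_power)
        show "T m * a m \<le> K" if m: "n0 \<le> m" for m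
        proof -
          have "T m * a m = 2 powr (- real m / real ?d) * 2 powr (real m / real ?d)
            * (r m * (\<Sum>I'\<in>W I m. shadow_size (S I')))"
            by (simp add: T_def a_def)
          also have "2 powr (- real m / real ?d) * 2 powr (real m / real ?d) = 1"
            by (simp flip: powr_add)
          finally have "T m * a m = r m * (\<Sum>I'\<in>W I m. shadow_size (S I'))" by simp
          also have "\<dots> \<le> r m * (\<Sum>J\<in>words m. shadow_size (S J))"
            using W[OF m] r_pos[of m] n0 m finite_words by (intro mult_left_mono sum_mono2) auto
          also have "\<dots> \<le> K" using K n0 m by simp
          finally show ?thesis .
        qed
        show "g m \<le> g m'" if "n0 \<le> m" "m \<le> m'" for m m'
          unfolding g_def using gap_mono gap_lmeasurable Ine n0 that
          by (intro measure_mono_fmeasurable) auto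
        show "T n \<le> w n m * T m + real ?d * c0 * g m / a n" if n: "n0 \<le> n" "n + s \<le> m" for n m
        proof -
          let ?P = "\<lambda>n. \<Sum>I'\<in>W I n. shadow_size (S I')"
          have rec: "?P n \<le> real C / k n m * ?P m + real ?d * c0 * g m / r n"
            unfolding g_def by (rule shadow_recursion) (use Ine I n n0 q r_pos k_pos in \<open>auto simp: n0_def s_def\<close>)
          have e1: "2 powr (- real n / real ?d) = 2 powr (real (m - n) / real ?d) * 2 powr (- real m / real ?d)"
            using n by (simp add: of_nat_diff diff_divide_distrib flip: powr_add)
          have e2: "2 powr (- real n / real ?d) * (x / r n) = x / a n" for x
            by (simp add: a_def powr_minus_divide)
          have "T n \<le> 2 powr (- real n / real ?d) * (real C / k n m * ?P m + real ?d * c0 * g m / r n)"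
            unfolding T_def by (intro mult_left_mono rec) auto
          also have "\<dots> = 2 powr (- real n / real ?d) * (real C / k n m * ?P m) + real ?d * c0 * g m / a n"
            by (simp only: distrib_left e2)
          also have "2 powr (- real n / real ?d) * (real C / k n m * ?P m) = w n m * T m"
            unfolding e1 by (simp add: w_def T_def)
          finally show ?thesis .
        qed
        show "0 < real ?d * c0" using c0_ge_1 by simp
        show "1 \<le> s" using q by (simp add: s_def)
      qed
      then obtain e where e: "n0 < e" and Te: "T n0 * (\<Sum>n\<in>{n0..<e}. a n) \<le> A0 * g e"
        by (auto simp: A0_def)
      let ?S = "\<Sum>n\<in>{n0..<e}. a n" and ?S' = "\<Sum>n\<in>{n0..<e + q}. a n"
      have S0: "0 \<le> ?S" using a_pos n0 by (intro sum_nonneg) (auto intro: less_imp_le)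
      \<comment> \<open>the next block starts \<open>q\<close> levels after \<open>e\<close>; doubling pays for the levels in between\<close>
      have S': "?S' \<le> F * ?S"
      proof -
        obtain e' where e': "e = Suc e'" using e by (cases e) auto
        have "a e' \<le> ?S" using e e' a_pos n0
          by (intro member_le_sum) (auto intro: less_imp_le)
        then have "a e \<le> 2 * ?S" using a_dbl[of e'] e e' n0 by simp
        then have "real q * 2 ^ q * a e \<le> real q * 2 ^ q * (2 * ?S)" by (intro mult_left_mono) auto
        moreover have "(\<Sum>n\<in>{e..<e + q}. a n) \<le> real q * 2 ^ q * a e"
          using a_dbl a_pos[of e] e n0 by (intro doubling_sum_le[of 1]) auto
        moreover have "?S' = ?S + (\<Sum>n\<in>{e..<e + q}. a n)"
          using e by (intro sum.atLeastLessThan_concat[symmetric]) auto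
        ultimately show ?thesis by (simp add: F_def algebra_simps)
      qed
      have "scaled_root n0 ^ \<kappa> / 2 ^ n0 * ?S \<le> A0 * g e"
        using mult_right_mono[OF T_ge S0] Te by linarith
      then have "scaled_root n0 ^ \<kappa> * ?S \<le> 2 ^ n0 * (A0 * g e)"
        by (simp add: field_simps)
      also have "\<dots> = A0 * 2 ^ q * (2 ^ l * g e)"
        by (simp add: n0_def power_add)
      also have "\<dots> \<le> A0 * 2 ^ q * (scaled_root l ^ ?d - scaled_root e ^ ?d)"
        unfolding g_def using I l e n0 A0 by (intro mult_left_mono gap_le_decrease) auto
      finally have main: "scaled_root n0 ^ \<kappa> * ?S \<le> A0 * 2 ^ q * (scaled_root l ^ ?d - scaled_root e ^ ?d)" .
      have F0: "0 \<le> F" by (simp add: F_def)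
      have "scaled_root n0 ^ \<kappa> * ?S' \<le> scaled_root n0 ^ \<kappa> * (F * ?S)"
        using S' scaled_root_nonneg by (intro mult_left_mono) auto
      also have "\<dots> \<le> F * (A0 * 2 ^ q * (scaled_root l ^ ?d - scaled_root e ^ ?d))"
        using mult_left_mono[OF main F0] by (simp add: mult_ac)
      finally have main': "scaled_root n0 ^ \<kappa> * ?S' \<le> F * A0 * 2 ^ q * (scaled_root l ^ Suc \<kappa> - scaled_root e ^ Suc \<kappa>)"
        by (simp add: \<kappa> mult.assoc)
      have "?S' \<le> F * A0 * 2 ^ q * real (Suc \<kappa>) * 2 ^ \<kappa> * (scaled_root l - scaled_root e)"
        by (rule root_difference_bound[OF _ _ _ True _ _ main'])
          (use scaled_root_nonneg scaled_root_antimono y_pos l e n0 F0 A0 a_pos in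
            \<open>auto intro!: sum_nonneg less_imp_le[of 0 "a _"]\<close>)
      then have "?S' \<le> A1 * (scaled_root l - scaled_root e)" by (simp add: A1_def \<kappa>)
      also have "\<dots> \<le> (A1 + A2) * (scaled_root l - scaled_root e)"
        using A12 e n0 by (intro weaken) auto
      finally show ?thesis using e n0 by (intro exI[of _ e]) (simp add: n0_def)
    qed
  qed
  then have "summable a"
    using a_pos A12 scaled_root_nonneg
    by (intro summable_if_block_sums_telescope[where y = scaled_root and A = "A1 + A2" and q = q])
      (auto intro: less_imp_le)
  then show False using nosum by simp
qed

end

section \<open>Construction of a separated system\<close>

lemma words_decompose_parallel:
  assumes "I \<parallel> J" "prefix I I'" "prefix J J'"
  shows "\<exists>i. i < length I \<and> i < length J \<and> take i I = take i J \<and> I ! i \<noteq> J ! i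
    \<and> take i I' = take i J' \<and> i < length I' \<and> i < length J' \<and> I' ! i = I ! i \<and> J' ! i = J ! i"
proof -
  obtain as b bs c cs where *: "b \<noteq> c" "I = as @ b # bs" "J = as @ c # cs"
    using parallel_decomp[OF assms(1)] by blast
  then show ?thesis using assms(2,3)
    by (intro exI[of _ "length as"]) (auto simp: prefix_def nth_append)
qed

text \<open>
  A Cantor set whose coordinates are refined cyclically: the letter at position \<open>i\<close> moves a point by
  \<open>w i\<close> or not at all in the coordinate direction number \<open>i mod d\<close>, so each direction is used
  once in \<open>d\<close> letters. Let \<open>t i\<close> bound the total of the moves at positions \<open>i, i + d, i + 2 d, \<dots>\<close>.
  Two words that first differ at \<open>i\<close> are at least \<open>w i - t (i + d)\<close> apart in that direction. For
  this to be at least \<open>h i\<close>, where \<open>w i = t i - t (i + d)\<close>, it is enough that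
  \<open>t i \<ge> 2 * t (i + d) + h i\<close>; such \<open>t\<close> exists exactly when the series converges.
\<close>

lemma separated_system_exists:
  fixes \<rho> :: "bool list \<Rightarrow> bool list \<Rightarrow> real" and b :: "nat \<Rightarrow> real"
  assumes \<rho>_le: "\<And>i I J. \<lbrakk>i < length I; i < length J; take i I = take i J; I ! i \<noteq> J ! i\<rbrakk> \<Longrightarrow> \<rho> I J \<le> b i"
    and b_nonneg: "\<And>i. 0 \<le> b i"
    and b_summable: "summable (\<lambda>i. 2 powr (real i / real CARD('d::finite)) * b i)"
  shows "\<exists>A :: bool list \<Rightarrow> (real ^ 'd) set. separated_system \<rho> A"
proof -
  let ?d = "CARD('d)"
  have d: "0 < ?d" by simp
  \<comment> \<open>the summand \<open>(1 / 4) ^ i\<close> keeps the sets disjoint where \<open>b i = 0\<close>\<close>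
  define h where "h i = b i + (1 / 4) ^ i" for i
  have h_pos: "0 < h i" for i using b_nonneg[of i] by (simp add: h_def add_nonneg_pos)
  define u where "u i = 2 powr (real i / real ?d) * h i" for i
  have u_nonneg: "0 \<le> u i" for i using h_pos[of i] by (simp add: u_def)
  have "summable (\<lambda>i. 2 powr (real i / real ?d) * (1 / 4 :: real) ^ i)"
  proof (rule summable_comparison_test')
    show "summable (\<lambda>i. (1 / 2 :: real) ^ i)" by (simp add: summable_geometric)
    fix i :: nat
    have "real i / real ?d \<le> real i" using d by (simp add: divide_le_eq mult_le_cancel_left1)
    then have "2 powr (real i / real ?d) \<le> 2 powr real i" by (intro powr_mono) auto
    then have "2 powr (real i / real ?d) * (1 / 4 :: real) ^ i \<le> 2 ^ i * (1 / 4) ^ i"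
      by (intro mult_right_mono) (auto simp: powr_realpow)
    also have "\<dots> = (1 / 2) ^ i" by (simp flip: power_mult_distrib)
    finally show "norm (2 powr (real i / real ?d) * (1 / 4 :: real) ^ i) \<le> (1 / 2) ^ i" by simp
  qed
  then have u_summable: "summable u"
    unfolding u_def h_def distrib_left by (intro summable_add b_summable)
  \<comment> \<open>iterating the requirement on \<open>t\<close> suggests this tail sum, which also counts the other directions\<close>
  define t where "t i = 2 powr (- real i / real ?d) * (\<Sum>j. u (j + i))" for i
  have t_nonneg: "0 \<le> t i" for i
    unfolding t_def using u_nonneg u_summable by (intro mult_nonneg_nonneg suminf_nonneg) (auto simp: summable_iff_shift)
  have t_split: "2 * t (i + ?d) + h i \<le> t i" for i
  proof -
    have e1: "2 powr (- real i / real ?d) = 2 * 2 powr (- real (i + ?d) / real ?d)"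
    proof -
      have "- real (i + ?d) / real ?d = - real i / real ?d - 1"
        using d by (simp add: field_simps)
      then show ?thesis by (simp add: powr_diff)
    qed
    have e2: "h i = 2 powr (- real i / real ?d) * u i"
      by (simp add: u_def powr_minus_divide)
    have "summable (\<lambda>j. u (j + i))" using u_summable by (simp add: summable_iff_shift)
    then have "(\<Sum>j. u (j + i)) = (\<Sum>j. u (j + ?d + i)) + (\<Sum>j<?d. u (j + i))"
      by (rule suminf_split_initial_segment)
    moreover have "u (0 + i) \<le> (\<Sum>j<?d. u (j + i))"
      using d u_nonneg by (intro member_le_sum) auto
    ultimately have "(\<Sum>j. u (j + (i + ?d))) + u i \<le> (\<Sum>j. u (j + i))"
      by (simp add: add_ac)
    then have "2 powr (- real i / real ?d) * ((\<Sum>j. u (j + (i + ?d))) + u i) \<le> t i"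
      unfolding t_def by (intro mult_left_mono) auto
    moreover have "2 powr (- real i / real ?d) * (\<Sum>j. u (j + (i + ?d))) = 2 * t (i + ?d)"
      unfolding e1 t_def by simp
    ultimately show ?thesis by (simp add: e2 distrib_left)
  qed
  define w where "w i = t i - t (i + ?d)" for i
  have w_ge: "h i + t (i + ?d) \<le> w i" for i using t_split[of i] by (simp add: w_def)
  have w_nonneg: "0 \<le> w i" for i using w_ge[of i] h_pos[of i] t_nonneg[of "i + ?d"] by linarith
  have later: "i + ?d \<le> j" if "i < j" "j mod ?d = i mod ?d" for i j
  proof -
    have "?d dvd j - i" using that by (simp add: mod_eq_dvd_iff_nat)
    then have "?d \<le> j - i" using that by (intro dvd_imp_le) auto
    then show ?thesis using that by simp
  qed
  have tail: "(\<Sum>i\<in>{i \<in> {n..<M}. i mod ?d = n mod ?d}. w i) \<le> t n" for n M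
  proof (induction "M - n" arbitrary: n rule: less_induct)
    case less
    show ?case
    proof (cases "n < M")
      case False
      then have empty: "{i \<in> {n..<M}. i mod ?d = n mod ?d} = {}" by auto
      show ?thesis unfolding empty using t_nonneg by simp
    next
      case True
      have eq: "{i \<in> {n..<M}. i mod ?d = n mod ?d}
        = insert n {i \<in> {n + ?d..<M}. i mod ?d = (n + ?d) mod ?d}"
        using True later[of n] by (auto simp: order.order_iff_strict)
      have "(\<Sum>i\<in>{i \<in> {n + ?d..<M}. i mod ?d = (n + ?d) mod ?d}. w i) \<le> t (n + ?d)"
        using True d by (intro less) linarith
      moreover have "(\<Sum>i\<in>{i \<in> {n..<M}. i mod ?d = n mod ?d}. w i)
        = w n + (\<Sum>i\<in>{i \<in> {n + ?d..<M}. i mod ?d = (n + ?d) mod ?d}. w i)"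
        unfolding eq using d by (subst sum.insert) auto
      ultimately show ?thesis by (simp add: w_def)
    qed
  qed
  obtain e :: "'d \<Rightarrow> nat" where e: "bij_betw e UNIV {0..<?d}"
    using ex_bij_betw_finite_nat[of "UNIV :: 'd set"] by auto
  have e_less: "e x < ?d" for x using e by (auto simp: bij_betw_def)
  define ones where "ones J x = {i \<in> {0..<length J}. i mod ?d = e x \<and> J ! i}" for J x
  define f :: "bool list \<Rightarrow> real ^ 'd" where "f J = (\<chi> x. \<Sum>i\<in>ones J x. w i)" for J
  have f_bounds: "\<bar>f J $ x\<bar> \<le> t (e x)" for J x
  proof -
    have "(\<Sum>i\<in>ones J x. w i) \<le> (\<Sum>i\<in>{i \<in> {e x..<length J}. i mod ?d = e x mod ?d}. w i)"
      using w_nonneg e_less[of x] by (intro sum_mono2) (auto simp: ones_def dest: sym[of "_ mod _"])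
    also have "\<dots> \<le> t (e x)" by (rule tail)
    finally show ?thesis using w_nonneg by (simp add: f_def sum_nonneg)
  qed
  have apart: "h i \<le> f J $ x - f J' $ x"
    if J: "take i J = take i J'" "i < length J" "i < length J'" "J ! i" "\<not> J' ! i" and x: "e x = i mod ?d"
    for J J' i x
  proof -
    define P where "P = {j \<in> {0..<i}. j mod ?d = e x \<and> J ! j}"
    have same: "J ! j = J' ! j" if "j < i" for j
      using J(1) that by (metis nth_take)
    have "sum w (insert i P) \<le> sum w (ones J x)"
      using J x w_nonneg by (intro sum_mono2) (auto simp: ones_def P_def)
    then have lower: "w i + sum w P \<le> f J $ x"
      by (simp add: f_def P_def)
    let ?L = "{j \<in> {i + ?d..<length J'}. j mod ?d = (i + ?d) mod ?d}"
    have "ones J' x \<subseteq> P \<union> ?L"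
    proof
      fix j assume j: "j \<in> ones J' x"
      then have "j \<noteq> i" using J(5) by (auto simp: ones_def)
      then consider "j < i" | "i < j" by linarith
      then show "j \<in> P \<union> ?L"
        by cases (use j x same later[of i j] in \<open>auto simp: ones_def P_def\<close>)
    qed
    then have "sum w (ones J' x) \<le> sum w (P \<union> ?L)"
      using w_nonneg by (intro sum_mono2) (auto simp: P_def)
    also have "\<dots> = sum w P + sum w ?L"
      by (rule sum.union_disjoint) (auto simp: P_def)
    also have "sum w ?L \<le> t (i + ?d)" by (rule tail)
    finally show ?thesis using lower w_ge[of i] by (simp add: f_def)
  qed
  define A where "A I = {f J | J. prefix I J}" for I
  have dist: "h i \<le> dist (f J) (f J')"
    if J: "take i J = take i J'" "i < length J" "i < length J'" "J ! i \<noteq> J' ! i" for i J J'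
  proof -
    have "i mod ?d \<in> e ` UNIV" using e d by (simp add: bij_betw_def)
    then obtain x where x: "e x = i mod ?d" by auto
    have "h i \<le> \<bar>f J $ x - f J' $ x\<bar>"
      using apart[of i J J' x] apart[of i J' J x] J x by (cases "J ! i") auto
    also have "\<dots> \<le> dist (f J) (f J')"
      using component_le_norm_cart[of "f J - f J'" x] by (simp add: dist_norm)
    finally show ?thesis .
  qed
  have A_ne: "A I \<noteq> {}" for I unfolding A_def by auto
  have "bounded (A I)" for I
  proof -
    have "norm (f J) \<le> (\<Sum>x\<in>UNIV. t (e x))" for J
      using norm_le_l1_cart[of "f J"] sum_mono[of UNIV "\<lambda>x. \<bar>f J $ x\<bar>" "\<lambda>x. t (e x)"] f_bounds
      by (meson order_trans)
    then show ?thesis unfolding A_def bounded_iff by blast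
  qed
  moreover have "A I \<subseteq> A J" if "prefix J I" for I J
    using that unfolding A_def by (auto intro: prefix_order.trans)
  moreover have far: "\<exists>i. \<rho> I J \<le> h i \<and> (h i \<le> dist p p')" if IJ: "I \<parallel> J" and p: "p \<in> A I" "p' \<in> A J" for I J p p'
  proof -
    obtain I' J' where *: "p = f I'" "prefix I I'" "p' = f J'" "prefix J J'"
      using p by (auto simp: A_def)
    obtain i where i: "i < length I" "i < length J" "take i I = take i J" "I ! i \<noteq> J ! i"
      "take i I' = take i J'" "i < length I'" "i < length J'" "I' ! i = I ! i" "J' ! i = J ! i"
      using words_decompose_parallel[OF IJ *(2,4)] by blast
    have "\<rho> I J \<le> h i" using \<rho>_le[OF i(1-4)] by (simp add: h_def add_increasing2)
    moreover have "h i \<le> dist p p'" unfolding * using i by (intro dist) auto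
    ultimately show ?thesis by blast
  qed
  moreover have "A I \<inter> A J = {}" if IJ: "I \<parallel> J" for I J
  proof (rule ccontr)
    assume "A I \<inter> A J \<noteq> {}"
    then obtain p where "p \<in> A I" "p \<in> A J" by blast
    then obtain i where "h i \<le> dist p p" using far[OF IJ] by blast
    then show False using h_pos[of i] by simp
  qed
  moreover have "\<rho> I J \<le> setdist (A I) (A J)" if IJ: "I \<parallel> J" for I J
    using far[OF IJ] by (intro le_setdistI A_ne) force
  ultimately have "separated_system \<rho> A"
    using A_ne unfolding separated_system_def by blast
  then show ?thesis by blast
qed

section \<open>The characterization\<close>

theorem corollary9:
  fixes \<rho> :: "bool list \<Rightarrow> bool list \<Rightarrow> real" and r :: "nat \<Rightarrow> real"
  assumes "2 \<le> CARD('d::finite)"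
    and "distance_function \<rho>"
    and "\<forall>n\<ge>1. \<forall>I\<in>words n. escape_radius \<rho> I = ereal (r n)"
    and "bounded_growth TYPE('d) \<rho> r"
    and "\<exists>c\<ge>1. \<forall>n\<ge>1. ereal (r n) \<le> ereal c * split_sup \<rho> n \<and>
           split_sup \<rho> n \<le> ereal c * ereal (r n)"
  shows "(\<exists>A :: bool list \<Rightarrow> (real ^ 'd) set. separated_system \<rho> A) \<longleftrightarrow>
    summable (\<lambda>n. 2 powr (real (Suc n) / real CARD('d)) * r (Suc n))"
    (is "?exists \<longleftrightarrow> ?summable")
proof
  assume ?exists
  then obtain C q k N and S :: "bool list \<Rightarrow> (real ^ 'd) set" and E W c0
    where C: "1 \<le> C" and q: "1 \<le> q"
    and r_pos: "\<forall>n\<ge>1. 0 < r n" and r_mono: "\<forall>n m. 1 \<le> n \<and> n \<le> m \<longrightarrow> r m \<le> r n"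
    and k_pos: "\<forall>n m. 1 \<le> n \<and> n \<le> m \<longrightarrow> 0 < k n m"
    and k_sum: "(SUP n\<in>{1..}. \<Sum>i. ennreal (2 powr (real i / real CARD('d)) / k n (n + i))) < \<infinity>"
    and N: "\<forall>n m. 1 \<le> n \<and> n + N \<le> m \<longrightarrow>
          2 powr (real (m - n) / real CARD('d)) / k n m < 1 / (4 * real C)"
    and sys: "admissible_system C q r k S E W c0"
    using mp[OF assms(4)[unfolded bounded_growth_def] \<open>?exists\<close>]
    by (elim conjE exE) (rule that; assumption)
  define H where "H = enn2real (SUP n\<in>{1..}. \<Sum>i. ennreal (2 powr (real i / real CARD('d)) / k n (n + i)))"
  have H: "(\<Sum>i<M. 2 powr (real i / real CARD('d)) / k n (n + i)) \<le> H" if n: "1 \<le> n" for n M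
  proof -
    let ?f = "\<lambda>i. 2 powr (real i / real CARD('d)) / k n (n + i)"
    have nonneg: "0 \<le> ?f i" for i using k_pos n by (simp add: less_imp_le)
    have "ennreal (\<Sum>i<M. ?f i) = (\<Sum>i<M. ennreal (?f i))"
      using nonneg by simp
    also have "\<dots> \<le> (\<Sum>i. ennreal (?f i))"
      by (rule sum_le_suminf) auto
    also have "\<dots> \<le> (SUP n\<in>{1..}. \<Sum>i. ennreal (2 powr (real i / real CARD('d)) / k n (n + i)))"
      using n by (intro SUP_upper) auto
    also have "\<dots> = ennreal H" using k_sum by (simp add: H_def)
    finally show ?thesis by (subst (asm) ennreal_le_iff) (auto simp: H_def)
  qed
  have "summable (\<lambda>n. 2 powr (real n / real CARD('d)) * r n)"
  proof (rule admissible_system.summable_radii[OF sys q C])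
    show "0 < r n" if "1 \<le> n" for n using r_pos that by blast
    show "r m \<le> r n" if "1 \<le> n" "n \<le> m" for n m using r_mono that by blast
    show "0 < k n m" if "1 \<le> n" "n \<le> m" for n m using k_pos that by blast
    show "2 powr (real (m - n) / real CARD('d)) / k n m < 1 / (4 * real C)"
      if "1 \<le> n" "n + N \<le> m" for n m using N that by blast
  qed (rule H)
  then show ?summable
    by (subst summable_Suc_iff)
next
  assume sum: ?summable
  interpret distance_function \<rho> by (rule assms(2))
  obtain c where c: "1 \<le> c" and split: "\<And>n. 1 \<le> n \<Longrightarrow> split_sup \<rho> n \<le> ereal c * ereal (r n)"
    using assms(5) by blast
  have bound: "\<rho> I J \<le> c * r (Suc i)"
    if "i < length I" "i < length J" "take i I = take i J" "I ! i \<noteq> J ! i" for i I J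
  proof -
    have "ereal (\<rho> I J) \<le> split_sup \<rho> (Suc i)"
      unfolding split_sup_def by (rule SUP_upper2[where i = "(I, J)"]) (use that in auto)
    also have "\<dots> \<le> ereal (c * r (Suc i))" using split[of "Suc i"] by simp
    finally show ?thesis by simp
  qed
  have nonneg_bound: "0 \<le> c * r (Suc i)" for i
  proof -
    let ?I = "replicate i True @ [True]" and ?J = "replicate i True @ [False]"
    have "0 \<le> \<rho> ?I ?J" by (rule nonneg) auto
    also have "\<dots> \<le> c * r (Suc i)" by (rule bound) (auto simp: nth_append)
    finally show ?thesis .
  qed
  let ?p = "2 powr (1 / real CARD('d))"
  have "summable (\<lambda>i. c / ?p * (2 powr (real (Suc i) / real CARD('d)) * r (Suc i)))"
    using sum by (rule summable_mult)
  also have "(\<lambda>i. c / ?p * (2 powr (real (Suc i) / real CARD('d)) * r (Suc i)))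
    = (\<lambda>i. 2 powr (real i / real CARD('d)) * (c * r (Suc i)))"
    by (simp add: fun_eq_iff add_divide_distrib powr_add)
  finally show ?exists
    using bound nonneg_bound by (intro separated_system_exists) auto
qed

end
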